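(* Let $I=[0,1]$ and let $K\subset I$ be the Cantor-type set determined by a sequence of numbers $\epsilon_n\in(0,1)$, $n\ge1$, such that $$\log\frac1{\epsilon_n}\le\frac{Cn}{\log n},\qquad n\ge2,$$ for some constant $C<1/(24\log2)$. Then $\mathrm{cap}(I\setminus K)=\mathrm{cap}(I)$, and consequently $K$ is an NED set.
   Context: Cantor-type set: given $\epsilon_n\in(0,1)$, let $K_0=I=[0,1]$ and inductively let $K_n$ be obtained from $K_{n-1}$ by removing from each connected component (a closed interval of length $\ell$) the concentric open middle interval of length $\epsilon_n\ell$. Then $K=\bigcap_{n=0}^\infty K_n$ (for $\epsilon_n=1/3$ for all $n$ this is the standard middle-third Cantor set). Logarithmic capacity: for compact $E\subset\mathbb C$, $\mathrm{cap}(E)=e^{-V}$, where $V=\inf_\nu\iint\log\frac{1}{|z-t|}\,d\nu(z)\,d\nu(t)$, the infimum being over all Borel probability measures $\nu$ supported in $E$. For a general set $E\subset\mathbb C$, $\mathrm{cap}(E)=\sup\{\mathrm{cap}(F):F\subset E,\ F\text{ compact}\}$ (inner capacity). NED sets: this is the removability class of Ahlfors and Beurling (sets removable for extremal distances, equivalently for holomorphic functions with finite Dirichlet integral). For compact subsets $K$ of an interval $I$ the notion is used through the Ahlfors–Beurling characterization: $K$ is NED if and only if $\mathrm{cap}(I\setminus K)=\mathrm{cap}(I)$. *)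

theory Defs
  imports "HOL-Probability.Probability" "HOL-Complex_Analysis.Complex_Analysis"
begin

section \<open>Cantor-type sets\<close>

text \<open>The open interval concentric with the bounded interval \<open>J\<close> whose length is \<open>e\<close> times the
  length of \<open>J\<close>.\<close>

definition middle_part :: "real \<Rightarrow> real set \<Rightarrow> real set" where
  "middle_part e J = ball (midpoint (Inf J) (Sup J)) (e * (Sup J - Inf J) / 2)"

text \<open>Only the values \<open>\<epsilon> n\<close> with \<open>n \<ge> 1\<close> are used.\<close>

primrec cantor_stage :: "(nat \<Rightarrow> real) \<Rightarrow> nat \<Rightarrow> real set" where
  "cantor_stage \<epsilon> 0 = {0..1}"
| "cantor_stage \<epsilon> (Suc n) =
     cantor_stage \<epsilon> n - (\<Union>J\<in>components (cantor_stage \<epsilon> n). middle_part (\<epsilon> (Suc n)) J)"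

definition cantor_type_set :: "(nat \<Rightarrow> real) \<Rightarrow> real set" where
  "cantor_type_set \<epsilon> = (\<Inter>n. cantor_stage \<epsilon> n)"


section \<open>Logarithmic capacity\<close>

definition log_kernel :: "complex \<Rightarrow> complex \<Rightarrow> ereal" where
  "log_kernel z t = (if z = t then \<infinity> else ereal (ln (1 / dist z t)))"

text \<open>The double integral of the kernel as an extended real number, written as the integral of the
  positive part minus the integral of the negative part (\<open>e2ennreal\<close> sends negative numbers to 0).
  The Bochner integral would assign the value 0 to divergent integrals. For measures supported in a
  compact set the second term is finite, so the difference is never of the form \<open>\<infinity> - \<infinity>\<close>.\<close>

definition log_energy :: "complex measure \<Rightarrow> ereal" where
  "log_energy \<nu> =
     enn2ereal (\<integral>\<^sup>+ z. (\<integral>\<^sup>+ t. e2ennreal (log_kernel z t) \<partial>\<nu>) \<partial>\<nu>) -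
     enn2ereal (\<integral>\<^sup>+ z. (\<integral>\<^sup>+ t. e2ennreal (- log_kernel z t) \<partial>\<nu>) \<partial>\<nu>)"

definition prob_measures_on :: "complex set \<Rightarrow> complex measure set" where
  "prob_measures_on E = {\<nu>. sets \<nu> = sets borel \<and> prob_space \<nu> \<and> emeasure \<nu> (- E) = 0}"

text \<open>The infimum of the energies; it is \<open>\<infinity>\<close> if \<open>E\<close> is empty.\<close>

definition robin_constant :: "complex set \<Rightarrow> ereal" where
  "robin_constant E = (INF \<nu>\<in>prob_measures_on E. log_energy \<nu>)"

text \<open>\<open>exp (- V)\<close> for \<open>V\<close> the Robin constant, with \<open>exp (- \<infinity>) = 0\<close>. Intended for compact sets, for
  which \<open>V > -\<infinity>\<close>.\<close>

definition compact_log_capacity :: "complex set \<Rightarrow> ennreal" where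
  "compact_log_capacity E =
     (case robin_constant E of ereal v \<Rightarrow> ennreal (exp (- v)) | PInfty \<Rightarrow> 0 | MInfty \<Rightarrow> top)"

text \<open>Inner capacity. On compact sets it agrees with \<^const>\<open>compact_log_capacity\<close>, since the latter
  is monotone. It may be infinite for unbounded sets.\<close>

definition log_capacity :: "complex set \<Rightarrow> ennreal" where
  "log_capacity E = (SUP F\<in>{F. compact F \<and> F \<subseteq> E}. compact_log_capacity F)"


section \<open>NED sets\<close>

definition dirichlet_integral :: "complex set \<Rightarrow> (complex \<Rightarrow> complex) \<Rightarrow> ennreal" where
  "dirichlet_integral S f = (\<integral>\<^sup>+ z\<in>S. ennreal ((norm (deriv f z))\<^sup>2) \<partial>lborel)"

text \<open>Compact sets that are removable for holomorphic functions with finite Dirichlet integral. This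
  is the Ahlfors--Beurling class of NED sets, which can equivalently be described by removability
  for extremal distances.\<close>

definition NED :: "complex set \<Rightarrow> bool" where
  "NED K \<longleftrightarrow> compact K \<and>
     (\<forall>U f. open U \<and> K \<subseteq> U \<and> f holomorphic_on (U - K) \<and> dirichlet_integral (U - K) f < \<infinity> \<longrightarrow>
        (\<exists>g. g holomorphic_on U \<and> (\<forall>z\<in>U - K. g z = f z)))"

end

theory Submission
  imports Defs "HOL-Real_Asymp.Real_Asymp"
begin

text \<open>
  Both conclusions come from one property of \<open>K\<close>. At stage \<open>n\<close> the set \<open>K\<close> is contained in \<open>2\<^sup>n\<close>
  disjoint intervals of a common length \<open>2 r \<le> 2\<^sup>-\<^sup>n\<close>, and the middle of each of them is a gap of
  relative length \<open>\<epsilon>\<^sub>n\<^sub>+\<^sub>1\<close>. The growth condition makes \<open>log (1 / \<epsilon>\<^sub>n\<^sub>+\<^sub>1)\<close> negligible in comparison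
  with \<open>log (1 / r)\<close>. This is \<open>log_porous\<close> below: the set can be covered by short, well separated
  intervals each of which contains, concentrically, a complementary interval whose relative length
  \<open>\<theta>\<close> satisfies \<open>log (1 / \<theta>) \<le> \<eta> log (1 / \<rho>)\<close> with \<open>\<eta>\<close> as small as desired.

  Contracting each of the covering intervals by the factor \<open>\<theta>\<close> towards its centre, and leaving all
  other points fixed, defines a map \<open>T\<close> (\<open>squeeze\<close>) from \<open>[0,1]\<close> into a compact subset of
  \<open>[0,1] - K\<close>.

  \<^emph>\<open>Capacity.\<close> The logarithmic kernel hardly grows under \<open>T\<close>. For two points in one covering interval it
  grows by \<open>log (1 / \<theta>)\<close>, which is at most \<open>\<eta>\<close> times the kernel; for two other points close together it
  grows by at most \<open>log 4\<close>, again a small fraction of the kernel; for points far apart \<open>T\<close> changes the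
  distance by a small fraction of itself. So the energy of the image of a probability measure
  exceeds the original energy by an arbitrarily small amount, and the complement of \<open>K\<close> has the full
  capacity of the interval (\<open>log_capacity_complement_log_porous\<close>).

  \<^emph>\<open>Removability.\<close> Let \<open>f\<close> be holomorphic off \<open>K\<close> with finite Dirichlet integral. By Cauchy's formula on
  the two halves of a rectangle cut along the real line, \<open>f\<close> is the Cauchy integral over the boundary
  of the whole rectangle once the integrals over the two lines at height \<open>\<plusminus>\<rho>\<close> cancel in
  the limit \<open>\<rho> \<rightarrow> 0\<close>. To compare \<open>f\<close> at \<open>x + i \<rho>\<close> and \<open>x - i \<rho>\<close>, join both points to the real point \<open>T x\<close>,
  which lies in a gap. The segments to \<open>T x\<close> sweep out the strip of height \<open>\<rho>\<close> with multiplicity at most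
  \<open>1 / \<theta>\<close>, so that the mean difference is at most a constant times \<open>\<surd>\<rho> / \<theta>\<close> by the inequality of the
  arithmetic and geometric mean, and this tends to 0 because \<open>1 / \<theta>\<close> is smaller than any
  negative power of \<open>\<rho>\<close>. This is \<open>jump_small\<close>; \<open>local_extension\<close> and \<open>NED_log_porous\<close> draw the conclusion.
\<close>

section \<open>The intervals of the construction\<close>

text \<open>A connected subset of the union cannot meet two pieces, because each piece and the union of the
  others are disjoint closed sets. The lemma identifies the components that the recursive definition
  of the stages refers to.\<close>

lemma components_Union_finite_disjoint:
  fixes \<A> :: "'a::topological_space set set"
  assumes fin: "finite \<A>"
    and pieces: "\<And>A. A \<in> \<A> \<Longrightarrow> closed A \<and> connected A \<and> A \<noteq> {}"
    and disj: "disjoint \<A>"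
  shows "components (\<Union>\<A>) = \<A>"
proof -
  have inside: "T \<subseteq> A" if T: "connected T" "T \<subseteq> \<Union>\<A>" and A: "A \<in> \<A>" "T \<inter> A \<noteq> {}" for T A
  proof -
    have cl: "closed (\<Union>(\<A> - {A}))"
      using fin pieces by (intro closed_Union) auto
    have "A \<inter> \<Union>(\<A> - {A}) \<inter> T = {}"
      using disj A by (auto simp: disjoint_def)
    moreover have "T \<subseteq> A \<union> \<Union>(\<A> - {A})" using T by auto
    moreover have "closed A" using pieces[OF A(1)] by simp
    ultimately have "A \<inter> T = {} \<or> \<Union>(\<A> - {A}) \<inter> T = {}"
      using cl by (rule connected_closedD[OF T(1)])
    then have "\<Union>(\<A> - {A}) \<inter> T = {}" using A by blast
    then show ?thesis using T by blast
  qed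
  have piece: "A \<in> components (\<Union>\<A>)" if A: "A \<in> \<A>" for A
  proof -
    have "T = A" if T: "A \<subseteq> T" "T \<subseteq> \<Union>\<A>" "connected T" for T
    proof -
      have "T \<inter> A \<noteq> {}" using T pieces[OF A] by auto
      then have "T \<subseteq> A" using inside[of T A] T A by simp
      then show ?thesis using T by simp
    qed
    then show ?thesis
      unfolding in_components_maximal using pieces[OF A] A by blast
  qed
  show ?thesis
  proof
    show "components (\<Union>\<A>) \<subseteq> \<A>"
    proof
      fix B assume B: "B \<in> components (\<Union>\<A>)"
      then obtain x where "x \<in> B" using in_components_nonempty by fastforce
      moreover have "B \<subseteq> \<Union>\<A>" using B by (rule in_components_subset)
      ultimately obtain A where A: "A \<in> \<A>" "x \<in> A" by blast
      then have "A = B"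
        using components_eq[OF piece[OF A(1)] B] \<open>x \<in> B\<close> by blast
      then show "B \<in> \<A>" using A by simp
    qed
  qed (use piece in blast)
qed

lemma middle_part_cball:
  assumes "0 < r"
  shows "middle_part e (cball c r) = ball c (e * r)"
proof -
  have "cball c r = {c - r..c + r}" by (auto simp: cball_def dist_real_def)
  then have "Inf (cball c r) = c - r" "Sup (cball c r) = c + r" using assms by auto
  moreover have "midpoint (c - r) (c + r) = c" by (simp add: midpoint_def)
  ultimately show ?thesis by (simp add: middle_part_def)
qed

lemma cantor_stage_Suc_intervals:
  assumes fin: "finite C" and r: "0 < r"
    and sep: "\<And>c d. c \<in> C \<Longrightarrow> d \<in> C \<Longrightarrow> c \<noteq> d \<Longrightarrow> 2 * r < dist c d"
    and stage: "cantor_stage \<epsilon> n = (\<Union>c\<in>C. cball c r)"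
    and e: "\<epsilon> (Suc n) < 1"
  shows "cantor_stage \<epsilon> (Suc n) = (\<Union>c\<in>C. cball c r - ball c (\<epsilon> (Suc n) * r))"
proof -
  have disj: "cball c r \<inter> cball d r = {}" if "c \<in> C" "d \<in> C" "c \<noteq> d" for c d
    using sep[OF that] by (auto simp: dist_real_def)
  have comp: "components (cantor_stage \<epsilon> n) = (\<lambda>c. cball c r) ` C"
    unfolding stage using fin r disj
    by (intro components_Union_finite_disjoint) (auto simp: disjoint_def)
  have sub: "ball c (\<epsilon> (Suc n) * r) \<subseteq> cball c r" for c
    using e r by (auto simp: mult_less_cancel_right2 intro: order.trans[OF less_imp_le])
      (smt (verit) mult_less_cancel_right2)
  have "cantor_stage \<epsilon> (Suc n) = (\<Union>c\<in>C. cball c r) - (\<Union>c\<in>C. ball c (\<epsilon> (Suc n) * r))"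
    using r by (simp add: comp middle_part_cball) (simp add: stage)
  also have "\<dots> = (\<Union>c\<in>C. cball c r - ball c (\<epsilon> (Suc n) * r))"
    using sub disj by fast
  finally show ?thesis .
qed

text \<open>Each interval \<open>[c - r, c + r]\<close> splits into two intervals with centres \<open>c \<plusminus> r (1 + e) / 2\<close> and radius
  \<open>r (1 - e) / 2\<close>. The strict separation of the centres is part of the induction because it is what
  makes the intervals the components of the stage.\<close>

lemma cantor_stage_intervals:
  assumes \<epsilon>: "\<forall>n\<ge>1. 0 < \<epsilon> n \<and> \<epsilon> n < 1"
  obtains C r where "finite C" "0 < r" "r \<le> (1/2) ^ Suc n"
    "\<And>c d. c \<in> C \<Longrightarrow> d \<in> C \<Longrightarrow> c \<noteq> d \<Longrightarrow> 2 * r < dist c d"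
    "\<And>c. c \<in> C \<Longrightarrow> cball c r \<subseteq> {0..1}"
    "cantor_stage \<epsilon> n = (\<Union>c\<in>C. cball c r)"
proof (induction n arbitrary: thesis)
  case 0
  show ?case
    by (rule 0[of "{1/2}" "1/2"]) (auto simp: dist_real_def abs_if split: if_splits)
next
  case (Suc n)
  obtain C r where C: "finite C" "0 < r" "r \<le> (1/2) ^ Suc n"
    "\<And>c d. c \<in> C \<Longrightarrow> d \<in> C \<Longrightarrow> c \<noteq> d \<Longrightarrow> 2 * r < dist c d"
    "\<And>c. c \<in> C \<Longrightarrow> cball c r \<subseteq> {0..1}"
    "cantor_stage \<epsilon> n = (\<Union>c\<in>C. cball c r)"
    using Suc.IH by blast
  define e where "e = \<epsilon> (Suc n)"
  have e: "0 < e" "e < 1" using \<epsilon> by (auto simp: e_def)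
  define s where "s = r * (1 + e) / 2"
  define r' where "r' = r * (1 - e) / 2"
  define C' where "C' = (\<lambda>c. c - s) ` C \<union> (\<lambda>c. c + s) ` C"
  have r': "0 < r'" "r' \<le> r / 2" using e C(2) by (auto simp: r'_def)
  have sr: "s + r' = r" "s - r' = e * r" by (auto simp: s_def r'_def field_simps)
  have er: "0 < e * r" using e C(2) by simp
  have split: "cball c r - ball c (e * r) = cball (c - s) r' \<union> cball (c + s) r'" for c
  proof -
    have "cball c r - ball c (e * r) = {c - r..c - e * r} \<union> {c + e * r..c + r}"
    proof -
      have "e * r < r" using e C(2) by simp
      then show ?thesis using er by (auto simp: dist_real_def)
    qed
    moreover have "cball (c - s) r' = {c - r..c - e * r}" "cball (c + s) r' = {c + e * r..c + r}"
      using sr by (auto simp: cball_eq_atLeastAtMost)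
    ultimately show ?thesis by simp
  qed
  show ?case
  proof (rule Suc.prems[of C' r'])
    show "finite C'" "0 < r'" using C r' by (auto simp: C'_def)
    show "r' \<le> (1/2) ^ Suc (Suc n)" using C(3) r' by simp
    show "cantor_stage \<epsilon> (Suc n) = (\<Union>c\<in>C'. cball c r')"
      using cantor_stage_Suc_intervals[OF C(1,2,4,6)] e split by (auto simp: e_def C'_def)
    show "cball c r' \<subseteq> {0..1}" if "c \<in> C'" for c
    proof -
      from that obtain d where d: "d \<in> C" "c = d - s \<or> c = d + s" by (auto simp: C'_def)
      then have "cball c r' \<subseteq> cball d r" using split[of d] by blast
      then show ?thesis using C(5) d by blast
    qed
    show "2 * r' < dist c d" if cd: "c \<in> C'" "d \<in> C'" "c \<noteq> d" for c d
    proof -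
      obtain c0 where c0: "c0 \<in> C" "c = c0 - s \<or> c = c0 + s" using cd by (auto simp: C'_def)
      obtain d0 where d0: "d0 \<in> C" "d = d0 - s \<or> d = d0 + s" using cd by (auto simp: C'_def)
      show ?thesis
      proof (cases "c0 = d0")
        case True
        then have "dist c d = 2 * s" using c0 d0 cd r' sr er by (auto simp: dist_real_def)
        then show ?thesis using sr er by linarith
      next
        case False
        from C(4)[OF c0(1) d0(1) this] show ?thesis using c0 d0 sr r'
          by (auto simp: dist_real_def abs_if split: if_splits)
      qed
    qed
  qed
qed

lemma cantor_stage_antimono: "m \<le> n \<Longrightarrow> cantor_stage \<epsilon> n \<subseteq> cantor_stage \<epsilon> m"
  by (induction rule: dec_induct) auto

lemma compact_cantor_type_set:
  assumes "\<forall>n\<ge>1. 0 < \<epsilon> n \<and> \<epsilon> n < 1"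
  shows "compact (cantor_type_set \<epsilon>)" and "cantor_type_set \<epsilon> \<subseteq> {0..1}"
proof -
  show sub: "cantor_type_set \<epsilon> \<subseteq> {0..1}"
    unfolding cantor_type_set_def by (rule INT_lower[of 0, simplified, THEN order.trans]) auto
  have "closed (cantor_stage \<epsilon> n)" for n
    using cantor_stage_intervals[OF assms, of n] closed_UN closed_cball by metis
  then have "closed (cantor_type_set \<epsilon>)"
    unfolding cantor_type_set_def by blast
  then show "compact (cantor_type_set \<epsilon>)"
    using sub by (meson bounded_closed_interval bounded_subset compact_eq_bounded_closed)
qed


section \<open>Porosity at small logarithmic cost\<close>

locale separated_balls =
  fixes C :: "real set" and \<rho> :: real
  assumes fin: "finite C" and pos: "0 < \<rho>"
    and sep: "\<And>c d. c \<in> C \<Longrightarrow> d \<in> C \<Longrightarrow> c \<noteq> d \<Longrightarrow> 2 * \<rho> \<le> dist c d"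

text \<open>The last inequality is the logarithmic cost of a gap: the gap may be far shorter than the interval
  around it, as long as \<open>1 / \<theta>\<close> is smaller than a small power of \<open>1 / \<rho>\<close>. The finite set \<open>Z\<close> allows a
  given interval with end points off \<open>K\<close> to be respected by the cover.\<close>

definition log_porous :: "real set \<Rightarrow> bool" where
  "log_porous K \<longleftrightarrow> (\<forall>\<eta>>0. \<forall>Z. finite Z \<and> Z \<inter> K = {} \<longrightarrow>
     (\<exists>C \<rho> \<theta>. separated_balls C \<rho> \<and> \<rho> < \<eta> \<and> 0 < \<theta> \<and> \<theta> \<le> 1/2 \<and>
        ln (1 / \<theta>) \<le> \<eta> * ln (1 / (2 * \<rho>)) \<and>
        K \<subseteq> (\<Union>c\<in>C. ball c \<rho>) \<and> (\<forall>c\<in>C. Z \<inter> ball c \<rho> = {}) \<and>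
        (\<forall>c\<in>C. cball c (\<theta> * \<rho>) \<subseteq> {0..1} - K)))"

text \<open>The cover consists of the intervals of stage \<open>n\<close>, slightly enlarged to be open neighbourhoods of \<open>K\<close>.
  Since the radius grows at most by the factor 2, the ratio \<open>\<theta> = \<epsilon>\<^sub>n\<^sub>+\<^sub>1 / 4\<close> keeps the contracted
  intervals well inside the gaps opened at stage \<open>n + 1\<close>. As \<open>r \<le> 2\<^sup>-\<^sup>n\<^sup>-\<^sup>1\<close>, the cost is acceptable as soon
  as \<open>log (4 / \<epsilon>\<^sub>n\<^sub>+\<^sub>1) \<le> \<eta> (n - 1) log 2\<close>.\<close>

lemma log_porous_cantor_type_set:
  assumes \<epsilon>: "\<forall>n\<ge>1. 0 < \<epsilon> n \<and> \<epsilon> n < 1"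
    and lim: "(\<lambda>n. ln (1 / \<epsilon> (Suc n)) / real n) \<longlonglongrightarrow> 0"
  shows "log_porous (cantor_type_set \<epsilon>)"
  unfolding log_porous_def
proof (intro allI impI)
  fix \<eta> :: real and Z :: "real set"
  assume \<eta>: "0 < \<eta>" and Z: "finite Z \<and> Z \<inter> cantor_type_set \<epsilon> = {}"
  have "\<forall>z\<in>Z. \<forall>\<^sub>F n in sequentially. z \<notin> cantor_stage \<epsilon> n"
  proof
    fix z assume "z \<in> Z"
    then obtain m where "z \<notin> cantor_stage \<epsilon> m" using Z by (auto simp: cantor_type_set_def)
    then show "\<forall>\<^sub>F n in sequentially. z \<notin> cantor_stage \<epsilon> n"
      using cantor_stage_antimono[of m _ \<epsilon>] by (auto simp: eventually_sequentially)
  qed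
  then have ev1: "\<forall>\<^sub>F n in sequentially. \<forall>z\<in>Z. z \<notin> cantor_stage \<epsilon> n"
    using Z by (simp add: eventually_ball_finite)
  have "(\<lambda>n. (ln 4 + \<eta> * ln 2) / real n + ln (1 / \<epsilon> (Suc n)) / real n) \<longlonglongrightarrow> 0 + 0"
    by (intro tendsto_add lim lim_const_over_n)
  then have "\<forall>\<^sub>F n in sequentially. (ln 4 + \<eta> * ln 2) / real n + ln (1 / \<epsilon> (Suc n)) / real n < \<eta> * ln 2"
    by (rule order_tendstoD) (use \<eta> in auto)
  moreover have "\<forall>\<^sub>F n in sequentially. (1/2) ^ n < \<eta>"
    by (rule order_tendstoD[OF LIMSEQ_power_zero]) (use \<eta> in auto)
  ultimately have "\<forall>\<^sub>F n in sequentially. 0 < n \<and> (\<forall>z\<in>Z. z \<notin> cantor_stage \<epsilon> n) \<and> (1/2) ^ n < \<eta> \<and>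
      (ln 4 + \<eta> * ln 2) / real n + ln (1 / \<epsilon> (Suc n)) / real n < \<eta> * ln 2"
    using ev1 eventually_gt_at_top[of 0] by eventually_elim auto
  then obtain n where n: "0 < n" "\<forall>z\<in>Z. z \<notin> cantor_stage \<epsilon> n" "(1/2) ^ n < \<eta>"
    "(ln 4 + \<eta> * ln 2) / real n + ln (1 / \<epsilon> (Suc n)) / real n < \<eta> * ln 2"
    by (auto dest: eventually_happens)
  define e where "e = \<epsilon> (Suc n)"
  have e: "0 < e" "e < 1" using \<epsilon> by (auto simp: e_def)
  obtain C r where C: "finite C" "0 < r" "r \<le> (1/2) ^ Suc n"
    "\<And>c d. c \<in> C \<Longrightarrow> d \<in> C \<Longrightarrow> c \<noteq> d \<Longrightarrow> 2 * r < dist c d"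
    "\<And>c. c \<in> C \<Longrightarrow> cball c r \<subseteq> {0..1}"
    "cantor_stage \<epsilon> n = (\<Union>c\<in>C. cball c r)"
    using cantor_stage_intervals[OF \<epsilon>] by blast
  \<comment> \<open>the largest admissible radius: all the competitors in the minimum exceed \<open>r\<close>\<close>
  define P where "P = {2 * r} \<union> (\<Union>c\<in>C. (\<lambda>d. dist c d / 2) ` (C - {c}) \<union> dist c ` Z)"
  have finP: "finite P" using C Z by (simp add: P_def)
  have P: "r < p" if "p \<in> P" for p
  proof -
    from that consider "p = 2 * r"
      | c where "c \<in> C" "p \<in> (\<lambda>d. dist c d / 2) ` (C - {c})"
      | c where "c \<in> C" "p \<in> dist c ` Z"
      unfolding P_def by (elim UnE UN_E) (simp only: singleton_iff, assumption+)
    then show ?thesis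
    proof cases
      case 1
      then show ?thesis using C(2) by simp
    next
      case (2 c)
      then obtain d where "p = dist c d / 2" "d \<in> C - {c}" by (elim imageE)
      then show ?thesis using C(4)[of c d] 2(1) by auto
    next
      case (3 c)
      then obtain z where z: "z \<in> Z" "p = dist c z" by auto
      then have "z \<notin> cball c r" using n(2) C(6) 3(1) by blast
      then show ?thesis using z by simp
    qed
  qed
  define \<rho> where "\<rho> = Min P"
  have \<rho>: "r < \<rho>" "\<rho> \<le> 2 * r"
    using P finP by (auto simp: \<rho>_def P_def intro!: Min_le)
  have le: "\<rho> \<le> p" if "p \<in> P" for p using that finP by (simp add: \<rho>_def)
  have sep: "2 * \<rho> \<le> dist c d" if "c \<in> C" "d \<in> C" "c \<noteq> d" for c d
  proof -
    have "dist c d / 2 \<in> P" using that unfolding P_def by blast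
    then show ?thesis using le by fastforce
  qed
  have Zd: "Z \<inter> ball c \<rho> = {}" if "c \<in> C" for c
  proof -
    have "dist c z \<in> P" if "z \<in> Z" for z using \<open>c \<in> C\<close> that unfolding P_def by blast
    then show ?thesis using le by (force simp: not_less)
  qed
  have hole: "cball c (e / 4 * \<rho>) \<subseteq> {0..1} - cantor_type_set \<epsilon>" if c: "c \<in> C" for c
  proof -
    have lt: "e / 4 * \<rho> < e * r" "e * r < r" using e \<rho> C(2) by auto
    have "cball c (e / 4 * \<rho>) \<subseteq> ball c (e * r)" using lt by auto
    moreover have "ball c (e * r) \<subseteq> cball c r" using lt by auto
    moreover have "ball c (e * r) \<inter> cantor_stage \<epsilon> (Suc n) = {}"
    proof -
      have "x \<notin> cball d r - ball d (e * r)" if x: "x \<in> ball c (e * r)" and d: "d \<in> C" for x d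
      proof (cases "d = c")
        case False
        then have "2 * r < dist c d" using C(4)[OF c d] by auto
        then show ?thesis using x lt dist_triangle[of c d x] by (auto simp: dist_commute)
      qed (use x in auto)
      then show ?thesis
        using cantor_stage_Suc_intervals[OF C(1,2,4,6)] e by (auto simp: e_def)
    qed
    moreover have "cantor_type_set \<epsilon> \<subseteq> cantor_stage \<epsilon> (Suc n)"
      unfolding cantor_type_set_def by (rule INT_lower) simp
    ultimately show ?thesis using C(5)[OF c] by blast
  qed
  have "2 * \<rho> \<le> 2 * (1/2) ^ n" using \<rho> C(3) by simp
  then have "ln (1 / (2 * (1/2) ^ n)) \<le> ln (1 / (2 * \<rho>))"
    using \<rho> C(2) by (subst ln_le_cancel_iff) (auto simp: field_simps)
  moreover have "ln (1 / (2 * (1/2) ^ n)) = (real n - 1) * ln (2::real)"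
    by (simp add: ln_div ln_mult ln_realpow algebra_simps)
  ultimately have "\<eta> * ((real n - 1) * ln 2) \<le> \<eta> * ln (1 / (2 * \<rho>))"
    using \<eta> by simp
  moreover have "ln 4 + ln (1 / e) \<le> \<eta> * ((real n - 1) * ln 2)"
  proof -
    have "(ln 4 + \<eta> * ln 2 + ln (1 / e)) / real n < \<eta> * ln 2"
      using n(4) by (simp only: e_def add_divide_distrib)
    then have "ln 4 + \<eta> * ln 2 + ln (1 / e) < \<eta> * ln 2 * real n"
      using n(1) by (subst (asm) pos_divide_less_eq) auto
    then show ?thesis by (simp add: algebra_simps)
  qed
  moreover have "ln (1 / (e / 4)) = ln 4 + ln (1 / e)"
    using e by (simp add: ln_div)
  ultimately have small: "ln (1 / (e / 4)) \<le> \<eta> * ln (1 / (2 * \<rho>))" by linarith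
  have "cantor_type_set \<epsilon> \<subseteq> (\<Union>c\<in>C. ball c \<rho>)"
  proof -
    have "cantor_type_set \<epsilon> \<subseteq> cantor_stage \<epsilon> n"
      unfolding cantor_type_set_def by (rule INT_lower) simp
    also have "\<dots> \<subseteq> (\<Union>c\<in>C. ball c \<rho>)"
      using \<rho>(1) by (force simp: C(6))
    finally show ?thesis .
  qed
  moreover have "\<rho> < \<eta>" using \<rho> C(3) n(3) by simp
  ultimately show "\<exists>C \<rho> \<theta>. separated_balls C \<rho> \<and> \<rho> < \<eta> \<and> 0 < \<theta> \<and> \<theta> \<le> 1/2 \<and>
        ln (1 / \<theta>) \<le> \<eta> * ln (1 / (2 * \<rho>)) \<and>
        cantor_type_set \<epsilon> \<subseteq> (\<Union>c\<in>C. ball c \<rho>) \<and> (\<forall>c\<in>C. Z \<inter> ball c \<rho> = {}) \<and>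
        (\<forall>c\<in>C. cball c (\<theta> * \<rho>) \<subseteq> {0..1} - cantor_type_set \<epsilon>)"
    using C(1,2) \<rho> e sep Zd hole small
    by (intro exI[of _ C] exI[of _ \<rho>] exI[of _ "e / 4"]) (auto simp: separated_balls_def)
qed

lemma ln_inverse_gap_sublinear:
  assumes \<epsilon>: "\<forall>n\<ge>1. 0 < \<epsilon> n \<and> \<epsilon> n < (1::real)"
    and C: "\<forall>n\<ge>2. ln (1 / \<epsilon> n) \<le> C * real n / ln (real n)"
  shows "(\<lambda>n. ln (1 / \<epsilon> (Suc n)) / real n) \<longlonglongrightarrow> 0"
proof (rule tendsto_sandwich[of "\<lambda>_. 0"])
  show "(\<lambda>n. (C * real (Suc n) / ln (real (Suc n))) / real n) \<longlonglongrightarrow> 0"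
    by real_asymp
  show "\<forall>\<^sub>F n in sequentially. ln (1 / \<epsilon> (Suc n)) / real n \<le> (C * real (Suc n) / ln (real (Suc n))) / real n"
    using eventually_gt_at_top[of 0]
  proof eventually_elim
    case (elim n)
    then show ?case using C[rule_format, of "Suc n"] by (intro divide_right_mono) auto
  qed
  show "\<forall>\<^sub>F n in sequentially. 0 \<le> ln (1 / \<epsilon> (Suc n)) / real n"
    using \<epsilon> by (intro always_eventually allI divide_nonneg_nonneg ln_ge_zero)
      (simp_all add: less_imp_le)
qed auto

section \<open>Squeezing the unit interval into the complement\<close>

text \<open>Contraction by the factor \<open>t\<close> of each ball \<open>ball c \<rho>\<close> towards its centre. Written as a sum, it is
  visibly Borel measurable, and affine in \<open>t\<close>; for disjoint balls at most one summand is nonzero.\<close>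

definition squeeze :: "real set \<Rightarrow> real \<Rightarrow> real \<Rightarrow> real \<Rightarrow> real" where
  "squeeze C \<rho> t x = x + (\<Sum>c\<in>C. if x \<in> ball c \<rho> then (t - 1) * (x - c) else 0)"

lemma squeeze_measurable [measurable (raw)]:
  assumes [measurable]: "t \<in> borel_measurable M" "x \<in> borel_measurable M"
  shows "(\<lambda>z. squeeze C \<rho> (t z) (x z)) \<in> borel_measurable M"
  unfolding squeeze_def mem_ball dist_real_def by measurable

lemma squeeze_affine: "squeeze C \<rho> t x = x + (1 - t) * (squeeze C \<rho> 0 x - x)"
proof -
  have "(\<Sum>c\<in>C. if x \<in> ball c \<rho> then (t - 1) * (x - c) else 0) =
      (\<Sum>c\<in>C. (1 - t) * (if x \<in> ball c \<rho> then (0 - 1) * (x - c) else 0))"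
    by (intro sum.cong) (auto simp: algebra_simps)
  then show ?thesis by (simp add: squeeze_def sum_distrib_left del: mem_ball)
qed

lemma squeeze_outside: "x \<notin> (\<Union>c\<in>C. ball c \<rho>) \<Longrightarrow> squeeze C \<rho> t x = x"
  by (simp add: squeeze_def)

context separated_balls
begin

lemma center_unique:
  assumes "c \<in> C" "d \<in> C" "x \<in> ball c \<rho>" "x \<in> ball d \<rho>"
  shows "c = d"
proof (rule ccontr)
  assume "c \<noteq> d"
  then have "2 * \<rho> \<le> dist c d" using assms sep by blast
  then show False using assms dist_triangle[of c d x] by (auto simp: dist_commute)
qed

lemma squeeze_inside:
  assumes "c \<in> C" "x \<in> ball c \<rho>"
  shows "squeeze C \<rho> t x = c + t * (x - c)"
proof -
  have "(\<Sum>d\<in>C. if x \<in> ball d \<rho> then (t - 1) * (x - d) else 0) =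
        (\<Sum>d\<in>C. if d = c then (t - 1) * (x - c) else 0)"
    using center_unique assms by (intro sum.cong) auto
  then show ?thesis
    using assms fin by (simp only: squeeze_def) (simp add: algebra_simps)
qed

text \<open>If \<open>x\<close> and \<open>y\<close> lie in the balls with centres \<open>c\<close> and \<open>d\<close>, their distance is at most \<open>2 |c - d|\<close>
  because \<open>|c - d| \<ge> 2 \<rho>\<close>. The contracted points are within \<open>\<rho> / 2\<close> of the centres, and so at distance at
  least \<open>|c - d| / 2\<close> from each other. Moreover each point moves by at most \<open>\<rho>\<close>.\<close>

lemma dist_squeeze:
  assumes t: "0 \<le> t" "t \<le> 1/2"
    and ne: "\<And>c. c \<in> C \<Longrightarrow> x \<in> ball c \<rho> \<Longrightarrow> y \<notin> ball c \<rho>"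
  shows "dist x y \<le> 4 * dist (squeeze C \<rho> t x) (squeeze C \<rho> t y)"
    and "dist x y \<le> dist (squeeze C \<rho> t x) (squeeze C \<rho> t y) + 2 * \<rho>"
proof -
  \<comment> \<open>\<open>x\<close> and \<open>y\<close> are described by centres \<open>c\<close>, \<open>d\<close> and radii \<open>a\<close>, \<open>b\<close>; a fixed point is its own
    centre, with radius 0\<close>
  have center: "\<exists>c a. 0 \<le> a \<and> a \<le> \<rho> \<and> \<bar>x - c\<bar> \<le> a \<and> \<bar>squeeze C \<rho> t x - c\<bar> \<le> a / 2 \<and> \<bar>squeeze C \<rho> t x - x\<bar> \<le> \<rho> \<and>
      (a = \<rho> \<and> c \<in> C \<and> x \<in> ball c \<rho> \<or> a = 0 \<and> c = x \<and> x \<notin> (\<Union>c\<in>C. ball c \<rho>))" for x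
  proof (cases "x \<in> (\<Union>c\<in>C. ball c \<rho>)")
    case True
    then obtain c where c: "c \<in> C" "x \<in> ball c \<rho>" by auto
    then have *: "\<bar>x - c\<bar> \<le> \<rho>" by (auto simp: dist_real_def)
    have "squeeze C \<rho> t x - c = t * (x - c)" "squeeze C \<rho> t x - x = (t - 1) * (x - c)"
      using squeeze_inside[OF c, of t] by (simp_all add: algebra_simps)
    moreover have "\<bar>t * (x - c)\<bar> \<le> 1/2 * \<rho>" "\<bar>(t - 1) * (x - c)\<bar> \<le> 1 * \<rho>"
      unfolding abs_mult by (rule mult_mono; use t * pos in simp)+
    ultimately show ?thesis using c * pos by (intro exI[of _ c] exI[of _ \<rho>]) auto
  next
    case False
    then show ?thesis using pos by (intro exI[of _ x] exI[of _ 0]) (simp add: squeeze_outside)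
  qed
  obtain c a where c: "0 \<le> a" "a \<le> \<rho>" "\<bar>x - c\<bar> \<le> a" "\<bar>squeeze C \<rho> t x - c\<bar> \<le> a / 2" "\<bar>squeeze C \<rho> t x - x\<bar> \<le> \<rho>"
     "a = \<rho> \<and> c \<in> C \<and> x \<in> ball c \<rho> \<or> a = 0 \<and> c = x \<and> x \<notin> (\<Union>c\<in>C. ball c \<rho>)"
    using center[of x] by blast
  obtain d b where d: "0 \<le> b" "b \<le> \<rho>" "\<bar>y - d\<bar> \<le> b" "\<bar>squeeze C \<rho> t y - d\<bar> \<le> b / 2" "\<bar>squeeze C \<rho> t y - y\<bar> \<le> \<rho>"
     "b = \<rho> \<and> d \<in> C \<and> y \<in> ball d \<rho> \<or> b = 0 \<and> d = y \<and> y \<notin> (\<Union>c\<in>C. ball c \<rho>)"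
    using center[of y] by blast
  have ab: "a + b \<le> \<bar>c - d\<bar>"
  proof -
    consider "a = \<rho>" "c \<in> C" "x \<in> ball c \<rho>" "b = \<rho>" "d \<in> C" "y \<in> ball d \<rho>"
      | "a = \<rho>" "c \<in> C" "b = 0" "d = y" "y \<notin> (\<Union>c\<in>C. ball c \<rho>)"
      | "b = \<rho>" "d \<in> C" "a = 0" "c = x" "x \<notin> (\<Union>c\<in>C. ball c \<rho>)"
      | "a = 0" "b = 0" using c(6) d(6) by blast
    then show ?thesis
    proof cases
      case 1
      then have "c \<noteq> d" using ne by blast
      then show ?thesis using sep[of c d] 1 by (simp add: dist_real_def)
    next
      case 2
      then have "y \<notin> ball c \<rho>" by blast
      then show ?thesis using 2(1,3,4) by (simp add: dist_real_def abs_minus_commute)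
    next
      case 3
      then have "x \<notin> ball d \<rho>" by blast
      then show ?thesis using 3(1,3,4) by (simp add: dist_real_def abs_minus_commute)
    qed auto
  qed
  show "dist x y \<le> 4 * dist (squeeze C \<rho> t x) (squeeze C \<rho> t y)"
  proof -
    have "\<bar>x - y\<bar> \<le> \<bar>c - d\<bar> + (a + b)" using c(3) d(3) by linarith
    moreover have "\<bar>c - d\<bar> - (a + b) / 2 \<le> \<bar>squeeze C \<rho> t x - squeeze C \<rho> t y\<bar>"
    proof -
      have "\<bar>c - d\<bar> \<le> \<bar>squeeze C \<rho> t x - squeeze C \<rho> t y\<bar> + (\<bar>squeeze C \<rho> t x - c\<bar> + \<bar>squeeze C \<rho> t y - d\<bar>)"
        by arith
      then show ?thesis using c(4) d(4) by (simp add: field_simps)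
    qed
    moreover have "A \<le> 4 * B" if "A \<le> D + s" "D - s / 2 \<le> B" "s \<le> D" for A B D s :: real
      using that by linarith
    ultimately show ?thesis using ab unfolding dist_real_def by blast
  qed
  show "dist x y \<le> dist (squeeze C \<rho> t x) (squeeze C \<rho> t y) + 2 * \<rho>"
    using c(5) d(5) unfolding dist_real_def by linarith
qed

end

lemma log_porousE:
  assumes "log_porous K" "0 < \<eta>" "finite Z" "Z \<inter> K = {}"
  obtains C \<rho> \<theta> where "separated_balls C \<rho>" "\<rho> < \<eta>" "0 < \<theta>" "\<theta> \<le> 1/2"
    "ln (1 / \<theta>) \<le> \<eta> * ln (1 / (2 * \<rho>))" "K \<subseteq> (\<Union>c\<in>C. ball c \<rho>)"
    "\<And>c. c \<in> C \<Longrightarrow> Z \<inter> ball c \<rho> = {}" "\<And>c. c \<in> C \<Longrightarrow> cball c (\<theta> * \<rho>) \<subseteq> {0..1} - K"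
  using assms(1)[unfolded log_porous_def, rule_format, OF assms(2) conjI, OF assms(3,4)] that
  by blast

text \<open>The map is \<^const>\<open>squeeze\<close> with ratio \<open>\<theta>\<close>. A pair of points in one ball pays \<open>log (1 / \<theta>)\<close>, which is
  covered by \<open>\<delta>\<close> times the kernel because the kernel there is at least \<open>log (1 / (2 \<rho>))\<close>. The threshold
  \<open>s\<close> separates the other pairs: below it, the factor 4 of \<open>dist_squeeze\<close> costs at most \<open>\<delta>\<close> times the
  kernel; above it, a displacement of \<open>2 \<rho>\<close> costs at most \<open>\<delta>\<close>.\<close>

lemma log_porous_transport:
  assumes K: "log_porous K" and \<delta>: "0 < \<delta>"
  obtains T F where "(T :: real \<Rightarrow> real) \<in> borel_measurable borel" "compact F" "F \<subseteq> {0..1} - K"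
    "\<And>x. x \<in> {0..1} \<Longrightarrow> T x \<in> F"
    "\<And>x y. x \<in> {0..1} \<Longrightarrow> y \<in> {0..1} \<Longrightarrow> x \<noteq> y \<Longrightarrow>
       T x \<noteq> T y \<and> ln (1 / dist (T x) (T y)) \<le> (1 + \<delta>) * ln (1 / dist x y) + \<delta>"
proof -
  \<comment> \<open>chosen so that \<open>\<delta> log (1 / s) = log 4\<close>\<close>
  define s where "s = exp (- ln 4 / \<delta>)"
  have s: "0 < s" "\<delta> * ln (1 / s) = ln 4" using \<delta> by (auto simp: s_def ln_div)
  \<comment> \<open>the second bound yields \<open>2 \<rho> \<le> \<delta> (s - 2 \<rho>)\<close>\<close>
  define \<eta> where "\<eta> = min \<delta> (\<delta> * s / (2 * (1 + \<delta>)))"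
  have \<eta>: "0 < \<eta>" "\<eta> \<le> \<delta>" "\<eta> \<le> \<delta> * s / (2 * (1 + \<delta>))" using \<delta> s by (auto simp: \<eta>_def)
  obtain C \<rho> \<theta> where C: "separated_balls C \<rho>" "\<rho> < \<eta>" "0 < \<theta>" "\<theta> \<le> 1/2"
    "ln (1 / \<theta>) \<le> \<eta> * ln (1 / (2 * \<rho>))" "K \<subseteq> (\<Union>c\<in>C. ball c \<rho>)"
    "\<And>c. c \<in> C \<Longrightarrow> cball c (\<theta> * \<rho>) \<subseteq> {0..1} - K"
    by (rule log_porousE[OF K \<eta>(1), of "{}"]) auto
  interpret separated_balls C \<rho> by (rule C(1))
  define T where "T = squeeze C \<rho> \<theta>"
  define F where "F = ({0..1} - (\<Union>c\<in>C. ball c \<rho>)) \<union> (\<Union>c\<in>C. cball c (\<theta> * \<rho>))"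
  show ?thesis
  proof (rule that[of T F])
    have "(\<lambda>x. squeeze C \<rho> \<theta> x) \<in> borel_measurable borel" by measurable
    then show "T \<in> borel_measurable borel" unfolding T_def .
    show "compact F"
      unfolding F_def using fin by (intro compact_Un compact_diff compact_UN) auto
    show "F \<subseteq> {0..1} - K" using C(6,7) by (auto simp: F_def)
    show "T x \<in> F" if "x \<in> {0..1}" for x
    proof (cases "x \<in> (\<Union>c\<in>C. ball c \<rho>)")
      case True
      then obtain c where c: "c \<in> C" "x \<in> ball c \<rho>" by auto
      then have "T x \<in> cball c (\<theta> * \<rho>)"
        using C(3) by (auto simp: T_def squeeze_inside dist_real_def abs_mult abs_minus_commute)
      then show ?thesis using c by (auto simp: F_def)
    next
      case False
      then show ?thesis using that by (simp add: T_def F_def squeeze_outside)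
    qed
    fix x y :: real
    assume xy: "x \<in> {0..1}" "y \<in> {0..1}" "x \<noteq> y"
    have d01: "0 < dist x y" "dist x y \<le> 1" using xy by (auto simp: dist_real_def)
    have k0: "0 \<le> ln (1 / dist x y)" using d01 by (simp add: ln_ge_zero_iff)
    show "T x \<noteq> T y \<and> ln (1 / dist (T x) (T y)) \<le> (1 + \<delta>) * ln (1 / dist x y) + \<delta>"
    proof (cases "\<exists>c\<in>C. x \<in> ball c \<rho> \<and> y \<in> ball c \<rho>")
      case True
      then obtain c where c: "c \<in> C" "x \<in> ball c \<rho>" "y \<in> ball c \<rho>" by auto
      then have "T x - T y = \<theta> * (x - y)" by (simp add: T_def squeeze_inside algebra_simps)
      then have d: "dist (T x) (T y) = \<theta> * dist x y" using C(3) by (simp add: dist_real_def abs_mult)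
      have "dist x y \<le> 2 * \<rho>" using c dist_triangle[of x y c] by (auto simp: dist_commute)
      then have "ln (1 / (2 * \<rho>)) \<le> ln (1 / dist x y)"
        using d01 pos by (subst ln_le_cancel_iff) (auto simp: field_simps)
      then have "\<eta> * ln (1 / (2 * \<rho>)) \<le> \<eta> * ln (1 / dist x y)" using \<eta> by simp
      also have "\<dots> \<le> \<delta> * ln (1 / dist x y)" using \<eta> k0 by (intro mult_right_mono) auto
      finally have "ln (1 / \<theta>) \<le> \<delta> * ln (1 / dist x y)" using C(5) by simp
      moreover have "ln (1 / (\<theta> * dist x y)) = ln (1 / \<theta>) + ln (1 / dist x y)"
        using C(3) d01 by (simp add: ln_div ln_mult)
      moreover have "T x \<noteq> T y" using d d01 C(3) by auto
      ultimately show ?thesis using \<delta> by (simp add: d algebra_simps)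
    next
      case False
      then have D: "dist x y \<le> 4 * dist (T x) (T y)" "dist x y \<le> dist (T x) (T y) + 2 * \<rho>"
        using dist_squeeze[of \<theta> x y] C(3,4) by (auto simp: T_def)
      define u where "u = dist (T x) (T y)"
      have u: "0 < u" unfolding u_def using D(1) d01(1) by linarith
      have "ln (dist x y / u) \<le> \<delta> * ln (1 / dist x y) + \<delta>"
      proof (cases "dist x y < s")
        case True
        have "dist x y / u \<le> 4"
          using D(1) by (subst pos_divide_le_eq[OF u]) (simp add: u_def mult.commute)
        then have "ln (dist x y / u) \<le> ln 4"
          using divide_pos_pos[OF d01(1) u] by (intro iffD2[OF ln_le_cancel_iff]) simp_all
        also have "\<dots> \<le> \<delta> * ln (1 / dist x y)"
          unfolding s(2)[symmetric] using True d01 s \<delta>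
          by (intro mult_left_mono, subst ln_le_cancel_iff) (auto simp: field_simps)
        finally show ?thesis using \<delta> by simp
      next
        case False
        have *: "2 * \<rho> * (1 + \<delta>) \<le> \<delta> * s"
        proof -
          have "2 * \<rho> * (1 + \<delta>) \<le> 2 * \<eta> * (1 + \<delta>)" using C(2) \<delta> by (intro mult_right_mono) auto
          also have "\<dots> \<le> \<delta> * s" using \<eta>(3) \<delta> by (simp add: field_simps)
          finally show ?thesis .
        qed
        have "s - 2 * \<rho> \<le> u" using D False by (simp add: u_def)
        then have "\<delta> * (s - 2 * \<rho>) \<le> \<delta> * u" using \<delta> by simp
        then have "2 * \<rho> \<le> \<delta> * u" using * by (simp add: algebra_simps)
        then have "dist x y / u \<le> 1 + \<delta>"
          using D(2) by (subst pos_divide_le_eq[OF u]) (simp add: u_def algebra_simps)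
        then have "ln (dist x y / u) \<le> ln (1 + \<delta>)"
          using divide_pos_pos[OF d01(1) u] \<delta> by (intro iffD2[OF ln_le_cancel_iff]) simp_all
        also have "\<dots> \<le> \<delta>" using ln_add_one_self_le_self \<delta> by simp
        finally show ?thesis using k0 \<delta> by (smt (verit) mult_nonneg_nonneg)
      qed
      moreover have "ln (1 / u) = ln (1 / dist x y) + ln (dist x y / u)"
        using u d01 by (simp add: ln_div)
      moreover have "T x \<noteq> T y" using u by (auto simp: u_def)
      ultimately show ?thesis by (simp add: u_def[symmetric] algebra_simps)
    qed
  qed
qed


section \<open>Energy and capacity\<close>

lemma log_kernel_measurable [measurable]:
  "(\<lambda>(z, t). log_kernel z t) \<in> borel_measurable (borel \<Otimes>\<^sub>M borel)"
  unfolding log_kernel_def by measurable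

lemma AE_prob_measures_on:
  assumes "\<nu> \<in> prob_measures_on E" "compact E"
  shows "AE z in \<nu>. z \<in> E"
proof (rule AE_I)
  show "{z \<in> space \<nu>. z \<notin> E} \<subseteq> - E" by auto
  show "emeasure \<nu> (- E) = 0" "- E \<in> sets \<nu>"
    using assms borel_comp[OF borel_compact] by (auto simp: prob_measures_on_def)
qed

lemma prob_measures_on_mono:
  assumes "E \<subseteq> F" "compact E"
  shows "prob_measures_on E \<subseteq> prob_measures_on F"
proof
  fix \<nu> assume \<nu>: "\<nu> \<in> prob_measures_on E"
  have "emeasure \<nu> (- F) \<le> emeasure \<nu> (- E)"
    using \<nu> assms borel_comp[OF borel_compact] by (intro emeasure_mono) (auto simp: prob_measures_on_def)
  then show "\<nu> \<in> prob_measures_on F" using \<nu> by (auto simp: prob_measures_on_def)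
qed

text \<open>On a set of diameter 1 the logarithmic kernel is nonnegative, so the energy is an integral of a
  nonnegative function.\<close>

lemma log_energy_unit_interval:
  assumes \<nu>: "\<nu> \<in> prob_measures_on (complex_of_real ` {0..1})"
  shows "log_energy \<nu> = enn2ereal (\<integral>\<^sup>+ z. (\<integral>\<^sup>+ t. e2ennreal (log_kernel z t) \<partial>\<nu>) \<partial>\<nu>)"
proof -
  have AE: "AE z in \<nu>. z \<in> complex_of_real ` {0..1}"
    by (rule AE_prob_measures_on[OF \<nu>]) (intro compact_continuous_image continuous_intros compact_Icc)
  have neg: "e2ennreal (- log_kernel z t) = 0"
    if "z \<in> complex_of_real ` {0..1}" "t \<in> complex_of_real ` {0..1}" for z t
  proof (cases "z = t")
    case False
    then have "0 < dist z t" "dist z t \<le> 1" using that by (auto simp: dist_of_real dist_real_def)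
    then have "- log_kernel z t \<le> 0" using False by (simp add: log_kernel_def)
    then show ?thesis by (rule e2ennreal_neg)
  qed (simp add: log_kernel_def e2ennreal_neg)
  have "(\<integral>\<^sup>+ z. (\<integral>\<^sup>+ t. e2ennreal (- log_kernel z t) \<partial>\<nu>) \<partial>\<nu>) = (\<integral>\<^sup>+ z. 0 \<partial>\<nu>)"
  proof (rule nn_integral_cong_AE, use AE in eventually_elim)
    case (elim z)
    have "(\<integral>\<^sup>+ t. e2ennreal (- log_kernel z t) \<partial>\<nu>) = (\<integral>\<^sup>+ t. 0 \<partial>\<nu>)"
      by (rule nn_integral_cong_AE, use AE in eventually_elim) (use neg elim in auto)
    then show ?case by simp
  qed
  then show ?thesis by (simp add: log_energy_def zero_ennreal.rep_eq)
qed

text \<open>The image measure under \<open>T\<close> has as its energy the integral of the kernel composed with \<open>T\<close>, and the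
  pointwise bound can be integrated since \<open>\<nu>\<close> has mass 1. On the diagonal both sides are infinite.\<close>

lemma log_energy_transport:
  assumes \<nu>: "\<nu> \<in> prob_measures_on (complex_of_real ` {0..1})" and \<delta>: "0 < \<delta>"
    and T: "(T :: real \<Rightarrow> real) \<in> borel_measurable borel" "\<And>x. x \<in> {0..1} \<Longrightarrow> T x \<in> F" and F: "F \<subseteq> {0..1}" "compact F"
    and le: "\<And>x y. x \<in> {0..1} \<Longrightarrow> y \<in> {0..1} \<Longrightarrow> x \<noteq> y \<Longrightarrow>
       T x \<noteq> T y \<and> ln (1 / dist (T x) (T y)) \<le> (1 + \<delta>) * ln (1 / dist x y) + \<delta>"
  shows "\<exists>\<mu>\<in>prob_measures_on (complex_of_real ` F). log_energy \<mu> \<le> ereal (1 + \<delta>) * log_energy \<nu> + ereal \<delta>"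
proof -
  note T(1) [measurable]
  define S where "S z = complex_of_real (T (Re z))" for z
  have S [measurable]: "S \<in> borel_measurable borel" unfolding S_def by measurable
  have sets [measurable_cong]: "sets \<nu> = sets borel" using \<nu> by (simp add: prob_measures_on_def)
  interpret prob_space \<nu> using \<nu> by (simp add: prob_measures_on_def)
  define \<mu> where "\<mu> = distr \<nu> borel S"
  have sets\<mu> [measurable_cong]: "sets \<mu> = sets borel" by (simp add: \<mu>_def)
  have compF: "compact (complex_of_real ` F)"
    using F by (intro compact_continuous_image continuous_intros)
  interpret \<mu>: prob_space \<mu> unfolding \<mu>_def by (rule prob_space_distr) measurable
  have AE: "AE z in \<nu>. z \<in> complex_of_real ` {0..1}"
    by (rule AE_prob_measures_on[OF \<nu>]) (intro compact_continuous_image continuous_intros compact_Icc)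
  have "AE z in \<mu>. z \<in> complex_of_real ` F"
    unfolding \<mu>_def
  proof (subst AE_distr_iff)
    show "AE z in \<nu>. S z \<in> complex_of_real ` F"
      using AE by eventually_elim (use T(2) in \<open>auto simp: S_def\<close>)
  qed (use compF in \<open>auto simp: borel_compact\<close>)
  then have "emeasure \<mu> (- complex_of_real ` F) = 0"
    using compF borel_comp[OF borel_compact[OF compF]]
    by (subst (asm) AE_iff_measurable[where N="- complex_of_real ` F"]) (auto simp: \<mu>_def)
  then have \<mu>F: "\<mu> \<in> prob_measures_on (complex_of_real ` F)"
    using \<mu>.prob_space_axioms by (simp add: prob_measures_on_def \<mu>_def)
  then have \<mu>I: "\<mu> \<in> prob_measures_on (complex_of_real ` {0..1})"
    using prob_measures_on_mono[of "complex_of_real ` F" "complex_of_real ` {0..1}"] F(1) compF by auto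
  have ptw: "e2ennreal (log_kernel (S z) (S t)) \<le> ennreal (1 + \<delta>) * e2ennreal (log_kernel z t) + ennreal \<delta>"
    if zt: "z \<in> complex_of_real ` {0..1}" "t \<in> complex_of_real ` {0..1}" for z t
  proof (cases "z = t")
    case True
    then show ?thesis using \<delta> by (simp add: log_kernel_def ennreal_mult_top)
  next
    case False
    from zt obtain x y where xy: "z = of_real x" "t = of_real y" "x \<in> {0..1}" "y \<in> {0..1}" by auto
    have "0 \<le> ln (1 / dist x y)" using xy False by (auto simp: dist_real_def intro!: ln_ge_zero)
    then show ?thesis using le[of x y] xy False \<delta>
      by (simp add: log_kernel_def S_def dist_of_real flip: ennreal_mult ennreal_plus)
  qed
  have "(\<integral>\<^sup>+ z. (\<integral>\<^sup>+ t. e2ennreal (log_kernel z t) \<partial>\<mu>) \<partial>\<mu>) =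
        (\<integral>\<^sup>+ z. (\<integral>\<^sup>+ t. e2ennreal (log_kernel (S z) (S t)) \<partial>\<nu>) \<partial>\<nu>)"
  proof -
    have int: "(\<integral>\<^sup>+ z. g z \<partial>\<mu>) = (\<integral>\<^sup>+ z. g (S z) \<partial>\<nu>)" if "g \<in> borel_measurable borel" for g
      unfolding \<mu>_def using that by (intro nn_integral_distr) auto
    have "(\<integral>\<^sup>+ z. (\<integral>\<^sup>+ t. e2ennreal (log_kernel z t) \<partial>\<mu>) \<partial>\<mu>) =
          (\<integral>\<^sup>+ z. (\<integral>\<^sup>+ t. e2ennreal (log_kernel (S z) t) \<partial>\<mu>) \<partial>\<nu>)"
      by (rule int) measurable
    also have "\<dots> = (\<integral>\<^sup>+ z. (\<integral>\<^sup>+ t. e2ennreal (log_kernel (S z) (S t)) \<partial>\<nu>) \<partial>\<nu>)"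
      by (intro nn_integral_cong int) measurable
    finally show ?thesis .
  qed
  also have "\<dots> \<le> (\<integral>\<^sup>+ z. ennreal (1 + \<delta>) * (\<integral>\<^sup>+ t. e2ennreal (log_kernel z t) \<partial>\<nu>) + ennreal \<delta> \<partial>\<nu>)"
  proof (rule nn_integral_mono_AE, use AE in eventually_elim)
    case (elim z)
    have "(\<integral>\<^sup>+ t. e2ennreal (log_kernel (S z) (S t)) \<partial>\<nu>) \<le>
          (\<integral>\<^sup>+ t. ennreal (1 + \<delta>) * e2ennreal (log_kernel z t) + ennreal \<delta> \<partial>\<nu>)"
      by (rule nn_integral_mono_AE, use AE in eventually_elim) (use elim ptw in auto)
    also have "\<dots> = ennreal (1 + \<delta>) * (\<integral>\<^sup>+ t. e2ennreal (log_kernel z t) \<partial>\<nu>) + ennreal \<delta>"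
      by (subst nn_integral_add) (auto simp: nn_integral_cmult emeasure_space_1)
    finally show ?case .
  qed
  also have "\<dots> = ennreal (1 + \<delta>) * (\<integral>\<^sup>+ z. (\<integral>\<^sup>+ t. e2ennreal (log_kernel z t) \<partial>\<nu>) \<partial>\<nu>) + ennreal \<delta>"
    by (subst nn_integral_add) (auto simp: nn_integral_cmult emeasure_space_1)
  finally have "enn2ereal (\<integral>\<^sup>+ z. (\<integral>\<^sup>+ t. e2ennreal (log_kernel z t) \<partial>\<mu>) \<partial>\<mu>) \<le>
      ereal (1 + \<delta>) * enn2ereal (\<integral>\<^sup>+ z. (\<integral>\<^sup>+ t. e2ennreal (log_kernel z t) \<partial>\<nu>) \<partial>\<nu>) + ereal \<delta>"
    using \<delta> by (simp add: less_eq_ennreal.rep_eq plus_ennreal.rep_eq times_ennreal.rep_eq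
      enn2ereal_ennreal del: ennreal_plus)
  then have "log_energy \<mu> \<le> ereal (1 + \<delta>) * log_energy \<nu> + ereal \<delta>"
    by (simp only: log_energy_unit_interval[OF \<mu>I] log_energy_unit_interval[OF \<nu>])
  then show ?thesis using \<mu>F by blast
qed

lemma compact_log_capacity_antimono:
  "robin_constant E \<le> robin_constant F \<Longrightarrow> compact_log_capacity F \<le> compact_log_capacity E"
  unfolding compact_log_capacity_def by (cases "robin_constant E"; cases "robin_constant F") auto

text \<open>Transporting nearly optimal measures for the interval gives compact subsets of the complement whose
  Robin constants exceed that of the interval by arbitrarily little. If the Robin constant of the
  interval were infinite, both capacities would be 0.\<close>

lemma log_capacity_complement_log_porous:
  assumes K: "log_porous K"
  shows "log_capacity (complex_of_real ` ({0..1} - K)) = log_capacity (complex_of_real ` {0..1})"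
proof (rule antisym)
  let ?I = "complex_of_real ` {0..1}"
  let ?J = "complex_of_real ` ({0..1} - K)"
  show "log_capacity ?J \<le> log_capacity ?I"
    unfolding log_capacity_def by (rule SUP_subset_mono) auto
  have capI: "compact_log_capacity F \<le> compact_log_capacity ?I" if "F \<subseteq> ?I" "compact F" for F
  proof (rule compact_log_capacity_antimono)
    have "prob_measures_on F \<subseteq> prob_measures_on ?I"
      using that by (intro prob_measures_on_mono)
    then show "robin_constant ?I \<le> robin_constant F"
      unfolding robin_constant_def by (rule INF_superset_mono) auto
  qed
  have "compact_log_capacity ?I \<le> log_capacity ?J"
  proof -
    have V0: "0 \<le> robin_constant ?I"
      unfolding robin_constant_def by (intro INF_greatest) (simp add: log_energy_unit_interval)
    then consider (fin) v where "robin_constant ?I = ereal v" "0 \<le> v" | (inf) "robin_constant ?I = \<infinity>"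
      by (cases "robin_constant ?I") auto
    then show ?thesis
    proof cases
      case inf
      then show ?thesis by (simp add: compact_log_capacity_def)
    next
      case (fin v)
      have lower: "ennreal (exp (- ((1 + \<delta>) * (v + \<delta>) + \<delta>))) \<le> log_capacity ?J" if \<delta>: "0 < \<delta>" for \<delta>
      proof (rule log_porous_transport[OF K \<delta>])
        fix T :: "real \<Rightarrow> real" and F
        assume TF: "T \<in> borel_measurable borel" "compact F" "F \<subseteq> {0..1} - K"
            "\<And>x. x \<in> {0..1} \<Longrightarrow> T x \<in> F"
            "\<And>x y. x \<in> {0..1} \<Longrightarrow> y \<in> {0..1} \<Longrightarrow> x \<noteq> y \<Longrightarrow>
              T x \<noteq> T y \<and> ln (1 / dist (T x) (T y)) \<le> (1 + \<delta>) * ln (1 / dist x y) + \<delta>"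
        have "robin_constant ?I < ereal (v + \<delta>)" using fin \<delta> by simp
        then obtain \<nu> where \<nu>: "\<nu> \<in> prob_measures_on ?I" "log_energy \<nu> < ereal (v + \<delta>)"
          unfolding robin_constant_def by (auto simp: INF_less_iff)
        have "F \<subseteq> {0..1}" using TF(3) by auto
        from log_energy_transport[OF \<nu>(1) \<delta> TF(1,4) this TF(2,5)]
        obtain \<mu> where \<mu>: "\<mu> \<in> prob_measures_on (complex_of_real ` F)"
          "log_energy \<mu> \<le> ereal (1 + \<delta>) * log_energy \<nu> + ereal \<delta>" by blast
        have "robin_constant (complex_of_real ` F) \<le> log_energy \<mu>"
          unfolding robin_constant_def using \<mu>(1) by (rule INF_lower)
        also have "\<dots> \<le> ereal (1 + \<delta>) * log_energy \<nu> + ereal \<delta>" by (rule \<mu>)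
        also have "\<dots> \<le> ereal (1 + \<delta>) * ereal (v + \<delta>) + ereal \<delta>"
          using \<nu>(2) \<delta> by (intro add_right_mono ereal_mult_left_mono) auto
        finally have le: "robin_constant (complex_of_real ` F) \<le> ereal ((1 + \<delta>) * (v + \<delta>) + \<delta>)"
          by simp
        have "ennreal (exp (- ((1 + \<delta>) * (v + \<delta>) + \<delta>))) \<le> compact_log_capacity (complex_of_real ` F)"
          unfolding compact_log_capacity_def
          using le by (cases "robin_constant (complex_of_real ` F)") (auto intro!: ennreal_leI)
        also have "\<dots> \<le> log_capacity ?J"
          unfolding log_capacity_def using TF(2,3)
          by (intro SUP_upper) (auto intro!: compact_continuous_image continuous_intros)
        finally show ?thesis .
      qed
      have "((\<lambda>\<delta>. ennreal (exp (- ((1 + \<delta>) * (v + \<delta>) + \<delta>)))) \<longlongrightarrow> ennreal (exp (- ((1 + 0) * (v + 0) + 0)))) (at_right 0)"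
        by (intro tendsto_intros)
      moreover have "\<forall>\<^sub>F \<delta> in at_right 0. ennreal (exp (- ((1 + \<delta>) * (v + \<delta>) + \<delta>))) \<le> log_capacity ?J"
        using eventually_at_right_less[of 0] by eventually_elim (rule lower)
      ultimately have "ennreal (exp (- ((1 + 0) * (v + 0) + 0))) \<le> log_capacity ?J"
        by (rule tendsto_upperbound) simp
      then show ?thesis by (simp add: compact_log_capacity_def fin)
    qed
  qed
  then show "log_capacity ?I \<le> log_capacity ?J"
    unfolding log_capacity_def[of ?I] using capI by (intro SUP_least) (auto intro: order.trans)
qed

section \<open>Integrals over lines and over the plane\<close>

text \<open>Fubini's theorem in the coordinates \<open>x + i y\<close>. The imaginary part comes first because the estimates
  below integrate over horizontal lines before they integrate over the height.\<close>

lemma lborel_complex_eq: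
  "(lborel :: complex measure) = distr (lborel \<Otimes>\<^sub>M lborel) borel (\<lambda>(y, x). Complex x y)"
proof (rule lborel_eqI)
  have meas [measurable]: "(\<lambda>(y, x). Complex x y) \<in> borel_measurable (lborel \<Otimes>\<^sub>M lborel)"
    unfolding Complex_eq by measurable
  show "sets (distr (lborel \<Otimes>\<^sub>M lborel) borel (\<lambda>(y, x). Complex x y)) = sets borel" by simp
  fix l u :: complex
  assume le_Basis: "\<And>b. b \<in> Basis \<Longrightarrow> l \<bullet> b \<le> u \<bullet> b"
  have le: "Re l \<le> Re u" "Im l \<le> Im u"
    using le_Basis[of 1] le_Basis[of \<i>] by (simp_all add: Basis_complex_def)
  have "(\<lambda>(y, x). Complex x y) -` box l u \<inter> space (lborel \<Otimes>\<^sub>M lborel) =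
        {Im l<..<Im u} \<times> {Re l<..<Re u}"
    by (auto simp: in_box_complex_iff space_pair_measure)
  then have "emeasure (distr (lborel \<Otimes>\<^sub>M lborel) borel (\<lambda>(y, x). Complex x y)) (box l u) =
        emeasure (lborel \<Otimes>\<^sub>M lborel) ({Im l<..<Im u} \<times> {Re l<..<Re u})"
    by (subst emeasure_distr) auto
  also have "\<dots> = ennreal (Im u - Im l) * ennreal (Re u - Re l)"
    using le by (subst lborel.emeasure_pair_measure_Times) auto
  also have "\<dots> = ennreal (\<Prod>b\<in>Basis. (u - l) \<bullet> b)"
    using le by (simp add: Basis_complex_def ennreal_mult mult.commute)
  finally show "emeasure (distr (lborel \<Otimes>\<^sub>M lborel) borel (\<lambda>(y, x). Complex x y)) (box l u) = \<dots>" .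
qed

lemma measurable_Complex [measurable (raw)]:
  assumes "f \<in> borel_measurable M" "g \<in> borel_measurable M"
  shows "(\<lambda>z. Complex (f z) (g z)) \<in> borel_measurable M"
  unfolding Complex_eq using assms by measurable

lemma nn_integral_complex:
  assumes [measurable]: "g \<in> borel_measurable borel"
  shows "(\<integral>\<^sup>+z. g z \<partial>lborel) = (\<integral>\<^sup>+y. \<integral>\<^sup>+x. g (Complex x y) \<partial>lborel \<partial>lborel)"
proof -
  have "(\<integral>\<^sup>+z. g z \<partial>lborel) = (\<integral>\<^sup>+p. g (case p of (y, x) \<Rightarrow> Complex x y) \<partial>(lborel \<Otimes>\<^sub>M lborel))"
    by (subst lborel_complex_eq, subst nn_integral_distr) auto
  also have "\<dots> = (\<integral>\<^sup>+y. \<integral>\<^sup>+x. g (Complex x y) \<partial>lborel \<partial>lborel)"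
    by (subst lborel.nn_integral_fst[symmetric]) (auto simp: case_prod_beta)
  finally show ?thesis .
qed

text \<open>On each ball the map multiplies lengths by \<open>t\<close>, elsewhere it is the identity, and it maps no two of these
  pieces to overlapping sets. So the image of Lebesgue measure has density at most \<open>1 / t\<close>.\<close>

lemma (in separated_balls) nn_integral_squeeze_le:
  assumes t: "0 < t" "t \<le> 1" and [measurable]: "G \<in> borel_measurable borel"
  shows "(\<integral>\<^sup>+x. G (squeeze C \<rho> t x) \<partial>lborel) \<le> ennreal (1 / t) * (\<integral>\<^sup>+x. G x \<partial>lborel)"
proof -
  define out where "out = - (\<Union>c\<in>C. ball c \<rho>)"
  have [measurable]: "ball c r \<in> sets borel" for c r :: real by simp
  have [measurable]: "out \<in> sets borel" unfolding out_def by (intro borel_comp borel_open open_UN) auto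
  have one: "indicator out x + (\<Sum>c\<in>C. indicator (ball c \<rho>) x) = (1::ennreal)" for x
  proof (cases "x \<in> out")
    case False
    then obtain c where c: "c \<in> C" "x \<in> ball c \<rho>" by (auto simp: out_def)
    have "(\<Sum>d\<in>C. indicator (ball d \<rho>) x) = (\<Sum>d\<in>C. if d = c then 1 else 0 :: ennreal)"
      using c center_unique by (intro sum.cong) (auto simp: indicator_def)
    then show ?thesis using False c fin by simp
  qed (auto simp: indicator_def out_def)
  have local: "(\<integral>\<^sup>+x. indicator (ball c \<rho>) x * G (squeeze C \<rho> t x) \<partial>lborel) \<le>
      ennreal (1 / t) * (\<integral>\<^sup>+x. indicator (ball c \<rho>) x * G x \<partial>lborel)" if c: "c \<in> C" for c
  proof -
    have *: "indicator (ball c \<rho>) x * G (squeeze C \<rho> t x) =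
        indicator (ball c (t * \<rho>)) ((c - t * c) + t * x) * G ((c - t * c) + t * x)" for x
    proof -
      have "c - ((c - t * c) + t * x) = t * (c - x)" by (simp add: algebra_simps)
      then have "dist c ((c - t * c) + t * x) = t * dist c x"
        unfolding dist_real_def using t by (simp add: abs_mult)
      then have "(c - t * c) + t * x \<in> ball c (t * \<rho>) \<longleftrightarrow> x \<in> ball c \<rho>" using t by simp
      moreover have "squeeze C \<rho> t x = (c - t * c) + t * x" if "x \<in> ball c \<rho>"
        using squeeze_inside[OF c that, of t] by (simp add: algebra_simps)
      ultimately show ?thesis by (simp add: indicator_def del: mem_ball)
    qed
    have "(\<integral>\<^sup>+x. indicator (ball c (t * \<rho>)) x * G x \<partial>lborel) =
        ennreal t * (\<integral>\<^sup>+x. indicator (ball c \<rho>) x * G (squeeze C \<rho> t x) \<partial>lborel)"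
      unfolding * using t by (subst nn_integral_real_affine[where t="c - t * c" and c=t]) auto
    then have "(\<integral>\<^sup>+x. indicator (ball c \<rho>) x * G (squeeze C \<rho> t x) \<partial>lborel) =
        ennreal (1 / t) * (\<integral>\<^sup>+x. indicator (ball c (t * \<rho>)) x * G x \<partial>lborel)"
      using t by (simp add: mult.assoc[symmetric] flip: ennreal_mult)
    also have "\<dots> \<le> ennreal (1 / t) * (\<integral>\<^sup>+x. indicator (ball c \<rho>) x * G x \<partial>lborel)"
    proof (intro mult_left_mono nn_integral_mono mult_right_mono)
      have "t * \<rho> \<le> \<rho>" using t pos by simp
      then show "indicator (ball c (t * \<rho>)) x \<le> (indicator (ball c \<rho>) x :: ennreal)" for x
        by (auto simp: indicator_def)
    qed auto
    finally show ?thesis .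
  qed
  have "(\<integral>\<^sup>+x. G (squeeze C \<rho> t x) \<partial>lborel) =
      (\<integral>\<^sup>+x. indicator out x * G (squeeze C \<rho> t x) + (\<Sum>c\<in>C. indicator (ball c \<rho>) x * G (squeeze C \<rho> t x)) \<partial>lborel)"
    by (intro nn_integral_cong) (simp add: one flip: distrib_right sum_distrib_right)
  also have "\<dots> = (\<integral>\<^sup>+x. indicator out x * G (squeeze C \<rho> t x) \<partial>lborel) +
      (\<Sum>c\<in>C. \<integral>\<^sup>+x. indicator (ball c \<rho>) x * G (squeeze C \<rho> t x) \<partial>lborel)"
    by (subst nn_integral_add) (auto simp: nn_integral_sum)
  also have "\<dots> \<le> ennreal (1 / t) * (\<integral>\<^sup>+x. indicator out x * G x \<partial>lborel) +
      (\<Sum>c\<in>C. ennreal (1 / t) * (\<integral>\<^sup>+x. indicator (ball c \<rho>) x * G x \<partial>lborel))"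
  proof (intro add_mono sum_mono local)
    have "(\<integral>\<^sup>+x. indicator out x * G (squeeze C \<rho> t x) \<partial>lborel) = (\<integral>\<^sup>+x. indicator out x * G x \<partial>lborel)"
      by (intro nn_integral_cong) (auto simp: indicator_def squeeze_outside out_def)
    also have "\<dots> = ennreal 1 * \<dots>" by simp
    also have "\<dots> \<le> ennreal (1 / t) * (\<integral>\<^sup>+x. indicator out x * G x \<partial>lborel)"
      using t by (intro mult_right_mono ennreal_leI) auto
    finally show "(\<integral>\<^sup>+x. indicator out x * G (squeeze C \<rho> t x) \<partial>lborel) \<le> \<dots>" .
  qed
  also have "\<dots> = ennreal (1 / t) *
      (\<integral>\<^sup>+x. indicator out x * G x + (\<Sum>c\<in>C. indicator (ball c \<rho>) x * G x) \<partial>lborel)"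
    by (subst nn_integral_add) (auto simp: nn_integral_sum distrib_left sum_distrib_left)
  also have "\<dots> = ennreal (1 / t) * (\<integral>\<^sup>+x. G x \<partial>lborel)"
    by (intro arg_cong2[where f="(*)"] refl nn_integral_cong) (simp add: one flip: distrib_right sum_distrib_right)
  finally show ?thesis .
qed

lemma norm_diff_le_nn_integral_deriv:
  assumes hol: "f holomorphic_on S" "open S" and seg: "closed_segment p q \<subseteq> S"
  shows "ennreal (norm (f q - f p)) \<le>
    ennreal (norm (q - p)) * (\<integral>\<^sup>+s. indicator {0..1} s * ennreal (norm (deriv f (p + of_real s * (q - p)))) \<partial>lborel)"
proof -
  define \<gamma> where "\<gamma> s = p + of_real s * (q - p)" for s :: real
  have \<gamma>S: "\<gamma> s \<in> S" if "s \<in> {0..1}" for s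
  proof -
    have "\<gamma> s \<in> closed_segment p q"
      using that unfolding closed_segment_def by (auto simp: \<gamma>_def scaleR_conv_of_real algebra_simps)
    then show ?thesis using seg by blast
  qed
  have der: "((\<lambda>s. f (\<gamma> s)) has_vector_derivative deriv f (\<gamma> s) * (q - p)) (at s within {0..1})"
    if "s \<in> {0..1}" for s
  proof -
    have 1: "(f has_field_derivative deriv f (\<gamma> s)) (at (\<gamma> s) within \<gamma> ` {0..1})"
      using holomorphic_derivI[OF hol \<gamma>S[OF that]] by blast
    have 2: "(\<gamma> has_vector_derivative (q - p)) (at s within {0..1})"
      unfolding \<gamma>_def by (auto intro!: derivative_eq_intros)
    show ?thesis
      using field_vector_diff_chain_within[OF 2 1] by (simp add: o_def mult.commute)
  qed
  have cont: "continuous_on {0..1} (\<lambda>s. deriv f (\<gamma> s) * (q - p))"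
  proof -
    have "continuous_on S (deriv f)"
      using hol by (intro holomorphic_on_imp_continuous_on holomorphic_deriv)
    moreover have "continuous_on {0..1} \<gamma>" unfolding \<gamma>_def by (intro continuous_intros)
    ultimately have "continuous_on {0..1} (\<lambda>s. deriv f (\<gamma> s))"
      by (rule continuous_on_compose2) (use \<gamma>S in auto)
    then show ?thesis by (intro continuous_intros)
  qed
  have int: "has_bochner_integral lborel (\<lambda>s. indicator {0..1} s *\<^sub>R (deriv f (\<gamma> s) * (q - p)))
      (f (\<gamma> 1) - f (\<gamma> 0))"
    by (rule has_bochner_integral_FTC_Icc) (use der cont in auto)
  have "ennreal (norm (f q - f p)) = ennreal (norm (f (\<gamma> 1) - f (\<gamma> 0)))" by (simp add: \<gamma>_def)
  also have "\<dots> \<le> (\<integral>\<^sup>+s. norm (indicator {0..1} s *\<^sub>R (deriv f (\<gamma> s) * (q - p))) \<partial>lborel)"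
    using integral_norm_bound_ennreal[of lborel "\<lambda>s. indicator {0..1} s *\<^sub>R (deriv f (\<gamma> s) * (q - p))"]
      int by (simp add: has_bochner_integral_iff)
  also have "\<dots> = (\<integral>\<^sup>+s. ennreal (norm (q - p)) * (indicator {0..1} s * ennreal (norm (deriv f (\<gamma> s)))) \<partial>lborel)"
    by (intro nn_integral_cong) (auto simp: indicator_def norm_mult ennreal_mult mult.commute)
  also have "\<dots> = ennreal (norm (q - p)) * (\<integral>\<^sup>+s. indicator {0..1} s * ennreal (norm (deriv f (\<gamma> s))) \<partial>lborel)"
  proof (rule nn_integral_cmult)
    have "continuous_on {0..1} (\<lambda>s. norm (deriv f (\<gamma> s)))"
      using hol \<gamma>S unfolding \<gamma>_def
      by (intro continuous_on_norm continuous_on_compose2[OF holomorphic_on_imp_continuous_on[OF holomorphic_deriv[OF hol]]] continuous_intros) auto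
    from borel_measurable_continuous_on_indicator[OF _ this]
    have [measurable]: "(\<lambda>s. indicator {0..1} s * norm (deriv f (\<gamma> s))) \<in> borel_measurable borel" by simp
    have "(\<lambda>s. ennreal (indicator {0..1} s * norm (deriv f (\<gamma> s)))) \<in> borel_measurable lborel" by measurable
    also have "(\<lambda>s. ennreal (indicator {0..1} s * norm (deriv f (\<gamma> s)))) =
       (\<lambda>s. indicator {0..1} s * ennreal (norm (deriv f (\<gamma> s))))"
      by (auto simp: indicator_def)
    finally show "(\<lambda>s. indicator {0..1} s * ennreal (norm (deriv f (\<gamma> s)))) \<in> borel_measurable lborel" .
  qed
  finally show ?thesis by (simp add: \<gamma>_def)
qed

text \<open>Parametrises two horizontal segments by the same real variable in order to compare the contour
  integrals over them point by point.\<close>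

lemma horizontal_integrals_diff_le:
  assumes \<alpha>\<beta>: "\<alpha> < \<beta>"
    and c1: "continuous_on (closed_segment (Complex \<alpha> y1) (Complex \<beta> y1)) \<phi>"
    and c2: "continuous_on (closed_segment (Complex \<alpha> y2) (Complex \<beta> y2)) \<phi>"
  shows "ennreal (norm (contour_integral (linepath (Complex \<alpha> y1) (Complex \<beta> y1)) \<phi> -
                        contour_integral (linepath (Complex \<alpha> y2) (Complex \<beta> y2)) \<phi>))
     \<le> (\<integral>\<^sup>+x. indicator {\<alpha>..\<beta>} x * ennreal (norm (\<phi> (Complex x y1) - \<phi> (Complex x y2))) \<partial>lborel)"
proof -
  define h where "h s = (\<phi> (Complex (\<alpha> + (\<beta> - \<alpha>) * s) y1) - \<phi> (Complex (\<alpha> + (\<beta> - \<alpha>) * s) y2)) * of_real (\<beta> - \<alpha>)" for s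
  have lp: "linepath (Complex \<alpha> y) (Complex \<beta> y) s = Complex (\<alpha> + (\<beta> - \<alpha>) * s) y" for y s
    by (simp add: linepath_def complex_eq_iff algebra_simps)
  have bm: "Complex \<beta> y - Complex \<alpha> y = of_real (\<beta> - \<alpha>)" for y by (simp add: complex_eq_iff)
  have I: "((\<lambda>s. \<phi> (Complex (\<alpha> + (\<beta> - \<alpha>) * s) y) * of_real (\<beta> - \<alpha>)) has_integral
      contour_integral (linepath (Complex \<alpha> y) (Complex \<beta> y)) \<phi>) {0..1}"
    if "continuous_on (closed_segment (Complex \<alpha> y) (Complex \<beta> y)) \<phi>" for y
    using has_contour_integral_integral[OF contour_integrable_continuous_linepath[OF that]]
    unfolding has_contour_integral_linepath lp bm .
  have hI: "(h has_integral (contour_integral (linepath (Complex \<alpha> y1) (Complex \<beta> y1)) \<phi> -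
      contour_integral (linepath (Complex \<alpha> y2) (Complex \<beta> y2)) \<phi>)) {0..1}"
    using has_integral_diff[OF I[OF c1] I[OF c2]] by (simp add: h_def[abs_def] left_diff_distrib)
  have cont: "continuous_on {0..1} h"
  proof -
    have "continuous_on {0..1} (\<lambda>s. \<phi> (Complex (\<alpha> + (\<beta> - \<alpha>) * s) y))"
      if "continuous_on (closed_segment (Complex \<alpha> y) (Complex \<beta> y)) \<phi>" for y
    proof (rule continuous_on_compose2[OF that])
      show "continuous_on {0..1} (\<lambda>s. Complex (\<alpha> + (\<beta> - \<alpha>) * s) y)"
        unfolding Complex_eq by (intro continuous_intros)
      show "(\<lambda>s. Complex (\<alpha> + (\<beta> - \<alpha>) * s) y) ` {0..1} \<subseteq> closed_segment (Complex \<alpha> y) (Complex \<beta> y)"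
        using linepath_image_01[of "Complex \<alpha> y" "Complex \<beta> y"] by (simp add: lp)
    qed
    from this[OF c1] this[OF c2] show ?thesis unfolding h_def by (intro continuous_intros)
  qed
  then have int: "set_integrable lborel {0..1} h" by (rule borel_integrable_atLeastAtMost')
  then have eq: "(LINT s|lborel. indicator {0..1} s *\<^sub>R h s) =
      contour_integral (linepath (Complex \<alpha> y1) (Complex \<beta> y1)) \<phi> -
      contour_integral (linepath (Complex \<alpha> y2) (Complex \<beta> y2)) \<phi>"
    using set_borel_integral_eq_integral(2)[OF int] hI
    by (simp add: set_lebesgue_integral_def integral_unique)
  have "ennreal (norm (LINT s|lborel. indicator {0..1} s *\<^sub>R h s)) \<le> (\<integral>\<^sup>+s. norm (indicator {0..1} s *\<^sub>R h s) \<partial>lborel)"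
    using int by (intro integral_norm_bound_ennreal) (simp add: set_integrable_def)
  also have "\<dots> = ennreal (\<beta> - \<alpha>) * (\<integral>\<^sup>+s. norm (indicator {\<alpha>..\<beta>} (\<alpha> + (\<beta> - \<alpha>) * s) *\<^sub>R
       (\<phi> (Complex (\<alpha> + (\<beta> - \<alpha>) * s) y1) - \<phi> (Complex (\<alpha> + (\<beta> - \<alpha>) * s) y2))) \<partial>lborel)"
  proof -
    have ind: "indicator {\<alpha>..\<beta>} (\<alpha> + (\<beta> - \<alpha>) * s) = (indicator {0..1} s :: real)" for s
    proof -
      have "\<alpha> + (\<beta> - \<alpha>) * s \<le> \<beta> \<longleftrightarrow> (\<beta> - \<alpha>) * s \<le> (\<beta> - \<alpha>) * 1" by auto
      then have "\<alpha> + (\<beta> - \<alpha>) * s \<in> {\<alpha>..\<beta>} \<longleftrightarrow> s \<in> {0..1}"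
        using \<alpha>\<beta> by (simp add: zero_le_mult_iff mult_le_cancel_left_pos del: mult_1_right)
      then show ?thesis by (simp add: indicator_def)
    qed
    have [measurable]: "(\<lambda>s. indicator {0..1} s *\<^sub>R h s) \<in> borel_measurable borel"
      using borel_measurable_continuous_on_indicator[OF _ cont] by simp
    have h': "norm (indicator {0..1} s *\<^sub>R h s) = (\<beta> - \<alpha>) * norm (indicator {\<alpha>..\<beta>} (\<alpha> + (\<beta> - \<alpha>) * s) *\<^sub>R
       (\<phi> (Complex (\<alpha> + (\<beta> - \<alpha>) * s) y1) - \<phi> (Complex (\<alpha> + (\<beta> - \<alpha>) * s) y2)))" for s
      using \<alpha>\<beta> by (simp add: h_def norm_mult ind del: of_real_diff)
    then have h'': "norm (indicator {\<alpha>..\<beta>} (\<alpha> + (\<beta> - \<alpha>) * s) *\<^sub>R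
       (\<phi> (Complex (\<alpha> + (\<beta> - \<alpha>) * s) y1) - \<phi> (Complex (\<alpha> + (\<beta> - \<alpha>) * s) y2))) =
       norm (indicator {0..1} s *\<^sub>R h s) / (\<beta> - \<alpha>)" for s
      using \<alpha>\<beta> by simp
    have "(\<integral>\<^sup>+s. norm (indicator {0..1} s *\<^sub>R h s) \<partial>lborel) =
        (\<integral>\<^sup>+s. ennreal (\<beta> - \<alpha>) * ennreal (norm (indicator {0..1} s *\<^sub>R h s) / (\<beta> - \<alpha>)) \<partial>lborel)"
      using \<alpha>\<beta> by (intro nn_integral_cong) (simp flip: ennreal_mult)
    also have "\<dots> = ennreal (\<beta> - \<alpha>) * (\<integral>\<^sup>+s. ennreal (norm (indicator {0..1} s *\<^sub>R h s) / (\<beta> - \<alpha>)) \<partial>lborel)"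
      by (rule nn_integral_cmult) measurable
    finally show ?thesis unfolding h'' .
  qed
  also have "\<dots> = (\<integral>\<^sup>+x. norm (indicator {\<alpha>..\<beta>} x *\<^sub>R (\<phi> (Complex x y1) - \<phi> (Complex x y2))) \<partial>lborel)"
  proof -
    have "continuous_on {\<alpha>..\<beta>} (\<lambda>x. \<phi> (Complex x y))"
      if "continuous_on (closed_segment (Complex \<alpha> y) (Complex \<beta> y)) \<phi>" for y
      by (rule continuous_on_compose2[OF that])
        (use \<alpha>\<beta> in \<open>auto simp: Complex_eq closed_segment_same_Im closed_segment_eq_real_ivl intro!: continuous_intros\<close>)
    from this[OF c1] this[OF c2]
    have "continuous_on {\<alpha>..\<beta>} (\<lambda>x. \<phi> (Complex x y1) - \<phi> (Complex x y2))" by (intro continuous_intros)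
    from borel_measurable_continuous_on_indicator[OF _ this]
    have [measurable]: "(\<lambda>x. indicator {\<alpha>..\<beta>} x *\<^sub>R (\<phi> (Complex x y1) - \<phi> (Complex x y2))) \<in> borel_measurable borel"
      by simp
    have "(\<integral>\<^sup>+x. norm (indicator {\<alpha>..\<beta>} x *\<^sub>R (\<phi> (Complex x y1) - \<phi> (Complex x y2))) \<partial>lborel) =
        ennreal \<bar>\<beta> - \<alpha>\<bar> * (\<integral>\<^sup>+s. norm (indicator {\<alpha>..\<beta>} (\<alpha> + (\<beta> - \<alpha>) * s) *\<^sub>R
       (\<phi> (Complex (\<alpha> + (\<beta> - \<alpha>) * s) y1) - \<phi> (Complex (\<alpha> + (\<beta> - \<alpha>) * s) y2))) \<partial>lborel)"
      by (rule nn_integral_real_affine) (measurable, use \<alpha>\<beta> in simp)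
    moreover have "\<bar>\<beta> - \<alpha>\<bar> = \<beta> - \<alpha>" using \<alpha>\<beta> by simp
    ultimately show ?thesis by (simp only:)
  qed
  also have "\<dots> = (\<integral>\<^sup>+x. indicator {\<alpha>..\<beta>} x * ennreal (norm (\<phi> (Complex x y1) - \<phi> (Complex x y2))) \<partial>lborel)"
    by (intro nn_integral_cong) (auto simp: indicator_def)
  finally show ?thesis by (simp add: eq)
qed

section \<open>Functions with finite Dirichlet integral on a slit rectangle\<close>

text \<open>The vertical sides of the rectangle avoid \<open>K\<close>, so that \<open>f\<close> is holomorphic in a neighbourhood of its
  boundary. Removability is a local question: a neighbourhood of a subset of \<open>[0,1]\<close> does not in general
  contain \<open>[0,1]\<close>, and each point of \<open>K\<close> is given a small rectangle of its own.\<close>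

locale slit_box =
  fixes U :: "complex set" and K :: "real set" and f :: "complex \<Rightarrow> complex" and \<alpha> \<beta> H :: real
  assumes openU: "open U" and closedK: "closed K"
    and hol: "f holomorphic_on U - complex_of_real ` K"
    and \<alpha>\<beta>: "\<alpha> < \<beta>" and H: "0 < H" and ends: "\<alpha> \<notin> K" "\<beta> \<notin> K"
    and box_sub: "cbox (Complex \<alpha> (-H)) (Complex \<beta> H) \<subseteq> U"
    and finite_dirichlet: "dirichlet_integral (U - complex_of_real ` K) f < \<infinity>"
begin

definition slit_rect :: "complex set" where "slit_rect = cbox (Complex \<alpha> (-H)) (Complex \<beta> H) - complex_of_real ` K"

text \<open>Extending \<open>|f'|\<close> by 0 off the slit rectangle makes it a Borel function on the plane, so that
  integrals over curved regions of points can be enlarged to integrals over whole lines and strips.\<close>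

definition grad :: "complex \<Rightarrow> ennreal" where "grad z = indicator slit_rect z * ennreal (norm (deriv f z))"

definition strip :: "real \<Rightarrow> ennreal" where
  "strip h = (\<integral>\<^sup>+y. indicator {-h..h} y * (\<integral>\<^sup>+x. grad (Complex x y) \<partial>lborel) \<partial>lborel)"

definition energy_bound :: real where
  "energy_bound = enn2real (dirichlet_integral (U - complex_of_real ` K) f) + 2 * (\<beta> - \<alpha>)"

lemma in_slit_rect: "z \<in> slit_rect \<longleftrightarrow> \<alpha> \<le> Re z \<and> Re z \<le> \<beta> \<and> \<bar>Im z\<bar> \<le> H \<and> (Im z = 0 \<longrightarrow> Re z \<notin> K)"
  by (auto simp: slit_rect_def in_cbox_complex_iff complex_eq_iff)

lemma open_domain: "open (U - complex_of_real ` K)"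
proof -
  have "complex_of_real ` K = Re -` K \<inter> {z. Im z = 0}" by (auto simp: image_iff complex_eq_iff)
  moreover have "closed (Re -` K)" using closedK by (intro closed_vimage continuous_intros)
  moreover have "closed {z. Im z = 0}" by (intro closed_Collect_eq continuous_intros)
  ultimately show ?thesis using openU by (auto intro!: open_Diff)
qed

lemma slit_rect_sub: "slit_rect \<subseteq> U - complex_of_real ` K" using box_sub by (auto simp: slit_rect_def)

lemma energy_bound_pos: "0 < energy_bound" using \<alpha>\<beta> by (simp add: energy_bound_def add_nonneg_pos)

lemma grad_measurable [measurable]: "grad \<in> borel_measurable borel"
proof -
  have "continuous_on (U - complex_of_real ` K) (deriv f)"
    using hol open_domain by (intro holomorphic_on_imp_continuous_on holomorphic_deriv)
  then have "continuous_on (U - complex_of_real ` K) (\<lambda>z. norm (deriv f z))" by (intro continuous_intros)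
  from borel_measurable_continuous_on_indicator[OF _ this] open_domain
  have [measurable]: "(\<lambda>z. indicator (U - complex_of_real ` K) z * norm (deriv f z)) \<in> borel_measurable borel"
    by simp
  have [measurable]: "cbox (Complex \<alpha> (-H)) (Complex \<beta> H) \<in> sets borel" by simp
  have "grad = (\<lambda>z. indicator (cbox (Complex \<alpha> (-H)) (Complex \<beta> H)) z *
      ennreal (indicator (U - complex_of_real ` K) z * norm (deriv f z)))"
    using box_sub by (auto simp: grad_def slit_rect_def indicator_def fun_eq_iff)
  also have "\<dots> \<in> borel_measurable borel" by measurable
  finally show ?thesis .
qed

text \<open>Integrates \<open>a \<le> t a\<^sup>2 + 1 / t\<close> for \<open>a = |f'|\<close> over the strip \<open>|y| \<le> h\<close>, with \<open>t = \<surd>h\<close>. The two terms of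
  \<open>energy_bound\<close> come from the Dirichlet integral and from the area \<open>2 h (\<beta> - \<alpha>)\<close> of the strip.\<close>

lemma strip_le:
  assumes h: "0 < h"
  shows "strip h \<le> ennreal (sqrt h * energy_bound)"
proof -
  define t where "t = sqrt h"
  have t: "0 < t" "t * t = h" using h by (auto simp: t_def)
  have young: "ennreal a \<le> ennreal (t * a\<^sup>2 + 1 / t)" if "0 \<le> a" for a
  proof (intro ennreal_leI)
    show "a \<le> t * a\<^sup>2 + 1 / t"
    proof (cases "a \<le> 1 / t")
      case False
      then have "a * 1 \<le> a * (t * a)" using t that by (intro mult_left_mono) (auto simp: field_simps)
      then show ?thesis using t by (simp add: power2_eq_square mult_ac add_increasing2)
    qed (use t in \<open>simp add: add_increasing\<close>)
  qed
  have ptw: "indicator {-h..h} y * grad (Complex x y) \<le>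
      ennreal t * (grad (Complex x y))\<^sup>2 + ennreal (1 / t) * (indicator {-h..h} y * indicator {\<alpha>..\<beta>} x)" for x y
  proof (cases "Complex x y \<in> slit_rect \<and> y \<in> {-h..h}")
    case True
    then have "x \<in> {\<alpha>..\<beta>}" by (simp add: in_slit_rect)
    then show ?thesis using True young[of "norm (deriv f (Complex x y))"] t
      by (simp add: grad_def ennreal_plus ennreal_mult ennreal_power)
  qed (auto simp: grad_def indicator_def)
  have dir: "(\<integral>\<^sup>+y. \<integral>\<^sup>+x. (grad (Complex x y))\<^sup>2 \<partial>lborel \<partial>lborel) \<le> ennreal (energy_bound - 2 * (\<beta> - \<alpha>))"
  proof -
    have "(\<integral>\<^sup>+y. \<integral>\<^sup>+x. (grad (Complex x y))\<^sup>2 \<partial>lborel \<partial>lborel) = (\<integral>\<^sup>+z. (grad z)\<^sup>2 \<partial>lborel)"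
      by (rule nn_integral_complex[symmetric]) measurable
    also have "\<dots> \<le> dirichlet_integral (U - complex_of_real ` K) f"
      unfolding dirichlet_integral_def using slit_rect_sub
      by (intro nn_integral_mono) (auto simp: grad_def indicator_def ennreal_power)
    also have "\<dots> = ennreal (energy_bound - 2 * (\<beta> - \<alpha>))"
      using finite_dirichlet by (simp add: energy_bound_def)
    finally show ?thesis .
  qed
  have area: "(\<integral>\<^sup>+y. \<integral>\<^sup>+x. indicator {-h..h} y * indicator {\<alpha>..\<beta>} x \<partial>lborel \<partial>lborel) = ennreal (2 * h * (\<beta> - \<alpha>))"
    using h \<alpha>\<beta> by (simp add: nn_integral_cmult nn_integral_multc flip: ennreal_mult)
  have "strip h = (\<integral>\<^sup>+y. \<integral>\<^sup>+x. indicator {-h..h} y * grad (Complex x y) \<partial>lborel \<partial>lborel)"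
    unfolding strip_def by (intro nn_integral_cong nn_integral_cmult[symmetric]) measurable
  also have "\<dots> \<le> (\<integral>\<^sup>+y. \<integral>\<^sup>+x. ennreal t * (grad (Complex x y))\<^sup>2 +
      ennreal (1 / t) * (indicator {-h..h} y * indicator {\<alpha>..\<beta>} x) \<partial>lborel \<partial>lborel)"
    by (intro nn_integral_mono ptw)
  also have "\<dots> = (\<integral>\<^sup>+y. ennreal t * (\<integral>\<^sup>+x. (grad (Complex x y))\<^sup>2 \<partial>lborel) +
      ennreal (1 / t) * (\<integral>\<^sup>+x. indicator {-h..h} y * indicator {\<alpha>..\<beta>} x \<partial>lborel) \<partial>lborel)"
    by (intro nn_integral_cong, subst nn_integral_add) (auto simp: nn_integral_cmult)
  also have "\<dots> = ennreal t * (\<integral>\<^sup>+y. \<integral>\<^sup>+x. (grad (Complex x y))\<^sup>2 \<partial>lborel \<partial>lborel) +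
      ennreal (1 / t) * (\<integral>\<^sup>+y. \<integral>\<^sup>+x. indicator {-h..h} y * indicator {\<alpha>..\<beta>} x \<partial>lborel \<partial>lborel)"
    by (subst nn_integral_add) (auto simp: nn_integral_cmult)
  also have "\<dots> \<le> ennreal t * ennreal (energy_bound - 2 * (\<beta> - \<alpha>)) + ennreal (1 / t) * ennreal (2 * h * (\<beta> - \<alpha>))"
    unfolding area by (intro add_right_mono mult_left_mono dir) auto
  also have "\<dots> = ennreal (t * (energy_bound - 2 * (\<beta> - \<alpha>)) + 1 / t * (2 * h * (\<beta> - \<alpha>)))"
    using t h \<alpha>\<beta> by (simp add: energy_bound_def flip: ennreal_mult ennreal_plus)
  also have "t * (energy_bound - 2 * (\<beta> - \<alpha>)) + 1 / t * (2 * h * (\<beta> - \<alpha>)) = t * energy_bound"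
    using t by (simp add: t(2)[symmetric] field_simps)
  finally show ?thesis by (simp add: t_def)
qed

lemma segment_le:
  assumes seg: "\<And>s. s \<in> {0..1} \<Longrightarrow> p + of_real s * (q - p) \<in> slit_rect"
  shows "ennreal (norm (f q - f p)) \<le>
    ennreal (norm (q - p)) * (\<integral>\<^sup>+s. indicator {0..1} s * grad (p + of_real s * (q - p)) \<partial>lborel)"
proof -
  have "closed_segment p q \<subseteq> U - complex_of_real ` K"
  proof
    fix z assume "z \<in> closed_segment p q"
    then obtain s where s: "0 \<le> s" "s \<le> 1" "z = (1 - s) *\<^sub>R p + s *\<^sub>R q"
      unfolding closed_segment_def by blast
    then have "z = p + of_real s * (q - p)" by (simp add: scaleR_conv_of_real algebra_simps)
    then show "z \<in> U - complex_of_real ` K" using seg[of s] s slit_rect_sub by auto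
  qed
  from norm_diff_le_nn_integral_deriv[OF hol open_domain this]
  have "ennreal (norm (f q - f p)) \<le>
    ennreal (norm (q - p)) * (\<integral>\<^sup>+s. indicator {0..1} s * ennreal (norm (deriv f (p + of_real s * (q - p)))) \<partial>lborel)" .
  also have "(\<integral>\<^sup>+s. indicator {0..1} s * ennreal (norm (deriv f (p + of_real s * (q - p)))) \<partial>lborel) =
      (\<integral>\<^sup>+s. indicator {0..1} s * grad (p + of_real s * (q - p)) \<partial>lborel)"
    using seg by (intro nn_integral_cong) (auto simp: grad_def indicator_def)
  finally show ?thesis .
qed

text \<open>Substitution \<open>y = y0 + r s\<close> in the integral over the height.\<close>

lemma vertical_le:
  assumes r: "r \<noteq> 0" and y: "\<And>s. s \<in> {0..1} \<Longrightarrow> \<bar>y0 + r * s\<bar> \<le> h"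
  shows "ennreal \<bar>r\<bar> * (\<integral>\<^sup>+s. indicator {0..1} s * (\<integral>\<^sup>+x. grad (Complex x (y0 + r * s)) \<partial>lborel) \<partial>lborel) \<le> strip h"
proof -
  have "ennreal \<bar>r\<bar> * (\<integral>\<^sup>+s. indicator {0..1} s * (\<integral>\<^sup>+x. grad (Complex x (y0 + r * s)) \<partial>lborel) \<partial>lborel)
    \<le> ennreal \<bar>r\<bar> * (\<integral>\<^sup>+s. indicator {-h..h} (y0 + r * s) * (\<integral>\<^sup>+x. grad (Complex x (y0 + r * s)) \<partial>lborel) \<partial>lborel)"
    using y by (intro mult_left_mono nn_integral_mono) (fastforce simp: indicator_def abs_le_iff)+
  also have "\<dots> = strip h"
    unfolding strip_def using r by (intro nn_integral_real_affine[symmetric]) measurable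
  finally show ?thesis .
qed

text \<open>Up to the factor \<open>2 \<rho>\<close>, the mean of \<open>|f'|\<close> along the segment from the real point \<open>squeeze C \<rho> \<theta> x\<close>
  (at \<open>s = 0\<close>) to \<open>x + i \<sigma> \<rho>\<close> (at \<open>s = 1\<close>), where \<open>\<sigma> = \<plusminus>1\<close> selects the half-plane. At height \<open>\<sigma> s \<rho>\<close> the
  segments over all \<open>x\<close> form the image of \<^const>\<open>squeeze\<close> with the ratio \<open>\<theta> + s (1 - \<theta>)\<close>, because
  \<^const>\<open>squeeze\<close> is affine in its ratio.\<close>

definition fan :: "real set \<Rightarrow> real \<Rightarrow> real \<Rightarrow> real \<Rightarrow> real \<Rightarrow> ennreal" where
  "fan C \<rho> \<theta> \<sigma> x = ennreal (2 * \<rho>) *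
     (\<integral>\<^sup>+s. indicator {0..1} s * grad (Complex (squeeze C \<rho> (\<theta> + s * (1 - \<theta>)) x) (\<sigma> * s * \<rho>)) \<partial>lborel)"

lemma fan_measurable [measurable]: "fan C \<rho> \<theta> \<sigma> \<in> borel_measurable borel"
  unfolding fan_def[abs_def] by measurable

text \<open>At each height the squeeze map has a ratio of at least \<open>\<theta>\<close>, so the segments cover the strip with
  multiplicity at most \<open>1 / \<theta>\<close>.\<close>

lemma nn_integral_fan_le:
  assumes C: "separated_balls C \<rho>" and \<theta>: "0 < \<theta>" "\<theta> \<le> 1/2" and \<sigma>: "\<bar>\<sigma>\<bar> = 1"
  shows "(\<integral>\<^sup>+x. fan C \<rho> \<theta> \<sigma> x \<partial>lborel) \<le> ennreal (2 / \<theta>) * strip \<rho>"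
proof -
  interpret separated_balls C \<rho> by (rule C)
  have meas: "(\<lambda>(s, x). indicator {0..1} s *
      grad (Complex (squeeze C \<rho> (\<theta> + s * (1 - \<theta>)) x) (\<sigma> * s * \<rho>))) \<in> borel_measurable (lborel \<Otimes>\<^sub>M lborel)"
    unfolding case_prod_beta by measurable
  have "(\<integral>\<^sup>+x. fan C \<rho> \<theta> \<sigma> x \<partial>lborel) = ennreal (2 * \<rho>) * (\<integral>\<^sup>+x. (\<integral>\<^sup>+s. indicator {0..1} s *
      grad (Complex (squeeze C \<rho> (\<theta> + s * (1 - \<theta>)) x) (\<sigma> * s * \<rho>)) \<partial>lborel) \<partial>lborel)"
    unfolding fan_def by (rule nn_integral_cmult) measurable
  also have "\<dots> = ennreal (2 * \<rho>) * (\<integral>\<^sup>+s. (\<integral>\<^sup>+x. indicator {0..1} s *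
      grad (Complex (squeeze C \<rho> (\<theta> + s * (1 - \<theta>)) x) (\<sigma> * s * \<rho>)) \<partial>lborel) \<partial>lborel)"
    by (subst lborel_pair.Fubini'[OF meas]) simp
  also have "\<dots> \<le> ennreal (2 * \<rho>) * (\<integral>\<^sup>+s. ennreal (1 / \<theta>) * (indicator {0..1} s *
      (\<integral>\<^sup>+x. grad (Complex x (0 + \<sigma> * \<rho> * s)) \<partial>lborel)) \<partial>lborel)"
  proof (intro mult_left_mono nn_integral_mono)
    fix s :: real
    show "(\<integral>\<^sup>+x. indicator {0..1} s * grad (Complex (squeeze C \<rho> (\<theta> + s * (1 - \<theta>)) x) (\<sigma> * s * \<rho>)) \<partial>lborel) \<le>
        ennreal (1 / \<theta>) * (indicator {0..1} s * (\<integral>\<^sup>+x. grad (Complex x (0 + \<sigma> * \<rho> * s)) \<partial>lborel))"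
    proof (cases "s \<in> {0..1}")
      case True
      define t where "t = \<theta> + s * (1 - \<theta>)"
      have "s * (1 - \<theta>) \<le> 1 - \<theta>" "0 \<le> s * (1 - \<theta>)"
        using True \<theta> by (simp_all add: mult_left_le_one_le)
      then have t: "\<theta> \<le> t" "t \<le> 1" by (auto simp: t_def)
      have "(\<integral>\<^sup>+x. grad (Complex (squeeze C \<rho> t x) (\<sigma> * s * \<rho>)) \<partial>lborel) \<le>
          ennreal (1 / t) * (\<integral>\<^sup>+x. grad (Complex x (\<sigma> * s * \<rho>)) \<partial>lborel)"
        using t \<theta> by (intro nn_integral_squeeze_le) auto
      also have "\<dots> \<le> ennreal (1 / \<theta>) * (\<integral>\<^sup>+x. grad (Complex x (\<sigma> * s * \<rho>)) \<partial>lborel)"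
        using t \<theta> by (intro mult_right_mono ennreal_leI) (auto simp: field_simps)
      finally show ?thesis using True by (simp add: t_def mult_ac)
    qed simp
  qed auto
  also have "\<dots> = ennreal (2 / \<theta>) * (ennreal \<bar>\<sigma> * \<rho>\<bar> * (\<integral>\<^sup>+s. indicator {0..1} s *
      (\<integral>\<^sup>+x. grad (Complex x (0 + \<sigma> * \<rho> * s)) \<partial>lborel) \<partial>lborel))"
  proof -
    have "ennreal (2 * \<rho>) * (ennreal (1 / \<theta>) * X) = ennreal (2 / \<theta>) * (ennreal \<bar>\<sigma> * \<rho>\<bar> * X)" for X
      using \<theta> \<sigma> pos by (simp add: abs_mult mult.assoc[symmetric] flip: ennreal_mult)
    then show ?thesis by (subst nn_integral_cmult) auto
  qed
  also have "\<dots> \<le> ennreal (2 / \<theta>) * strip \<rho>"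
  proof (intro mult_left_mono vertical_le)
    show "\<sigma> * \<rho> \<noteq> 0" using \<sigma> pos by auto
    show "\<bar>0 + \<sigma> * \<rho> * s\<bar> \<le> \<rho>" if "s \<in> {0..1}" for s
      using that \<sigma> pos by (simp add: abs_mult mult_left_le)
  qed auto
  finally show ?thesis .
qed

text \<open>The segment meets the real line only at \<open>squeeze C \<rho> \<theta> x\<close>, which is not in \<open>K\<close>: inside a ball it
  lies in the hole of the ball, outside it is \<open>x\<close> itself, which the cover of \<open>K\<close> misses. The segment
  stays in the rectangle since no ball contains \<open>\<alpha>\<close> or \<open>\<beta>\<close>, and its length is at most \<open>2 \<rho>\<close>.\<close>

lemma norm_diff_squeeze_le:
  assumes C: "separated_balls C \<rho>" and \<theta>: "0 < \<theta>" "\<theta> \<le> 1/2" and \<sigma>: "\<bar>\<sigma>\<bar> = 1" and \<rho>H: "\<rho> \<le> H"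
    and cover: "K \<subseteq> (\<Union>c\<in>C. ball c \<rho>)" and out: "\<And>c. c \<in> C \<Longrightarrow> {\<alpha>, \<beta>} \<inter> ball c \<rho> = {}"
    and hole: "\<And>c. c \<in> C \<Longrightarrow> cball c (\<theta> * \<rho>) \<inter> K = {}"
    and x: "x \<in> {\<alpha>..\<beta>}"
  shows "ennreal (norm (f (Complex x (\<sigma> * \<rho>)) - f (of_real (squeeze C \<rho> \<theta> x)))) \<le> fan C \<rho> \<theta> \<sigma> x"
proof -
  interpret separated_balls C \<rho> by (rule C)
  define p where "p = complex_of_real (squeeze C \<rho> \<theta> x)"
  define q where "q = Complex x (\<sigma> * \<rho>)"
  have pt: "p + of_real s * (q - p) = Complex (squeeze C \<rho> (\<theta> + s * (1 - \<theta>)) x) (\<sigma> * s * \<rho>)" for s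
  proof -
    have 1: "squeeze C \<rho> t x = x + (1 - t) * (squeeze C \<rho> 0 x - x)" for t by (rule squeeze_affine)
    show ?thesis
      by (simp add: p_def q_def complex_eq_iff 1[of \<theta>] 1[of "\<theta> + s * (1 - \<theta>)"]) (simp add: algebra_simps)
  qed
  have sq: "squeeze C \<rho> t x \<in> {\<alpha>..\<beta>} \<and> \<bar>squeeze C \<rho> t x - x\<bar> \<le> \<rho>" if t: "0 \<le> t" "t \<le> 1" for t
  proof (cases "x \<in> (\<Union>c\<in>C. ball c \<rho>)")
    case True
    then obtain c where c: "c \<in> C" "x \<in> ball c \<rho>" by auto
    have "\<alpha> \<notin> ball c \<rho>" "\<beta> \<notin> ball c \<rho>" using out[OF c(1)] by auto
    then have ab: "\<alpha> \<le> c - \<rho>" "c + \<rho> \<le> \<beta>" using c x by (auto simp: dist_real_def)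
    have "\<bar>t * (x - c)\<bar> \<le> 1 * \<rho>" "\<bar>(1 - t) * (x - c)\<bar> \<le> 1 * \<rho>"
      unfolding abs_mult by (rule mult_mono; use t c pos in \<open>simp add: dist_real_def abs_minus_commute\<close>)+
    moreover have "squeeze C \<rho> t x = c + t * (x - c)" by (rule squeeze_inside[OF c])
    moreover have "squeeze C \<rho> t x - x = - ((1 - t) * (x - c))"
      using squeeze_inside[OF c, of t] by (simp add: algebra_simps)
    ultimately show ?thesis using ab by (simp add: abs_le_iff)
  next
    case False
    then show ?thesis using x pos by (simp add: squeeze_outside)
  qed
  have segment_in_slit_rect: "p + of_real s * (q - p) \<in> slit_rect" if s: "s \<in> {0..1}" for s
  proof -
    have "s * (1 - \<theta>) \<le> 1 - \<theta>" "0 \<le> s * (1 - \<theta>)"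
      using s \<theta> by (simp_all add: mult_left_le_one_le)
    then have t: "0 \<le> \<theta> + s * (1 - \<theta>)" "\<theta> + s * (1 - \<theta>) \<le> 1"
      using \<theta> by (linarith, linarith)
    have "\<bar>\<sigma> * s * \<rho>\<bar> = s * \<rho>" using s \<sigma> pos by (simp add: abs_mult)
    moreover have "s * \<rho> \<le> 1 * \<rho>" using s pos by (intro mult_right_mono) auto
    ultimately have "\<bar>\<sigma> * s * \<rho>\<bar> \<le> H" using \<rho>H by linarith
    moreover have "squeeze C \<rho> (\<theta> + s * (1 - \<theta>)) x \<notin> K" if "\<sigma> * s * \<rho> = 0"
    proof -
      have s0: "s = 0" using that \<sigma> pos by auto
      show ?thesis
      proof (cases "x \<in> (\<Union>c\<in>C. ball c \<rho>)")
        case True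
        then obtain c where c: "c \<in> C" "x \<in> ball c \<rho>" by auto
        have "dist c (squeeze C \<rho> \<theta> x) = \<theta> * dist c x"
          unfolding squeeze_inside[OF c] dist_real_def using \<theta>
          by (simp add: abs_mult abs_minus_commute)
        also have "\<dots> \<le> \<theta> * \<rho>" using c \<theta> by simp
        finally have "squeeze C \<rho> \<theta> x \<in> cball c (\<theta> * \<rho>)" by simp
        then have "squeeze C \<rho> \<theta> x \<notin> K" using hole[OF c(1)] by blast
        then show ?thesis using s0 by simp
      next
        case False
        then have "x \<notin> K" using cover by blast
        then show ?thesis using s0 False by (simp add: squeeze_outside)
      qed
    qed
    ultimately show ?thesis
      using sq[OF t] by (simp only: pt in_slit_rect complex.sel atLeastAtMost_iff) blast
  qed
  have "norm (q - p) \<le> \<bar>Re (q - p)\<bar> + \<bar>Im (q - p)\<bar>" by (rule cmod_le)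
  also have "\<dots> \<le> 2 * \<rho>"
  proof -
    have "\<bar>Re (q - p)\<bar> = \<bar>squeeze C \<rho> \<theta> x - x\<bar>"
      by (simp only: p_def q_def minus_complex.sel complex.sel Re_complex_of_real abs_minus_commute)
    also have "\<dots> \<le> \<rho>" using sq[of \<theta>] \<theta> by simp
    finally have "\<bar>Re (q - p)\<bar> \<le> \<rho>" .
    moreover have "\<bar>Im (q - p)\<bar> = \<rho>" using \<sigma> pos by (simp add: p_def q_def abs_mult)
    ultimately show ?thesis by linarith
  qed
  finally have "ennreal (norm (q - p)) \<le> ennreal (2 * \<rho>)" by (rule ennreal_leI)
  then have len: "ennreal (norm (q - p)) * X \<le> ennreal (2 * \<rho>) * X" for X
    by (rule mult_right_mono) (rule zero_le)
  define X where "X = (\<integral>\<^sup>+s. indicator {0..1} s * grad (p + of_real s * (q - p)) \<partial>lborel)"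
  have fan: "fan C \<rho> \<theta> \<sigma> x = ennreal (2 * \<rho>) * X" unfolding X_def fan_def pt by (rule refl)
  have "ennreal (norm (f q - f p)) \<le> ennreal (norm (q - p)) * X"
    unfolding X_def by (rule segment_le) (rule segment_in_slit_rect)
  also note len
  finally show ?thesis by (simp only: p_def q_def fan)
qed

text \<open>Bounds \<open>|f|\<close> in the mean on horizontal lines, uniformly as the line approaches the slit, by
  integrating \<open>f'\<close> vertically down from the top side, where \<open>f\<close> is bounded.\<close>

lemma line_le:
  assumes h: "0 < h" "h < H" and M: "\<And>x. x \<in> {\<alpha>..\<beta>} \<Longrightarrow> norm (f (Complex x H)) \<le> M"
  shows "(\<integral>\<^sup>+x. indicator {\<alpha>..\<beta>} x * ennreal (norm (f (Complex x h))) \<partial>lborel) \<le>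
    ennreal (M * (\<beta> - \<alpha>)) + strip H"
proof -
  have "norm (f (Complex \<alpha> H)) \<le> M" using M[of \<alpha>] \<alpha>\<beta> by simp
  then have M0: "0 \<le> M" by (rule order.trans[OF norm_ge_zero])
  have ptw: "indicator {\<alpha>..\<beta>} x * ennreal (norm (f (Complex x h))) \<le>
      ennreal M * indicator {\<alpha>..\<beta>} x +
      ennreal \<bar>H - h\<bar> * (\<integral>\<^sup>+s. indicator {0..1} s * grad (Complex x (h + (H - h) * s)) \<partial>lborel)" for x
  proof (cases "x \<in> {\<alpha>..\<beta>}")
    case True
    have pt: "Complex x h + of_real s * (Complex x H - Complex x h) = Complex x (h + (H - h) * s)" for s
      by (simp add: complex_eq_iff)
    have "Complex x h + of_real s * (Complex x H - Complex x h) \<in> slit_rect" if s: "s \<in> {0..1}" for s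
    proof -
      have "(H - h) * s \<le> H - h" "0 \<le> (H - h) * s"
        using s h by (simp_all add: mult_left_le)
      then have "h + (H - h) * s \<le> H" "0 < h + (H - h) * s" using h by linarith+
      then show ?thesis unfolding pt in_slit_rect using True by auto
    qed
    from segment_le[OF this]
    have "ennreal (norm (f (Complex x H) - f (Complex x h))) \<le>
        ennreal \<bar>H - h\<bar> * (\<integral>\<^sup>+s. indicator {0..1} s * grad (Complex x (h + (H - h) * s)) \<partial>lborel)"
      unfolding pt by (simp add: cmod_def)
    moreover have "norm (f (Complex x h)) \<le> M + norm (f (Complex x H) - f (Complex x h))"
      using M[OF True] norm_triangle_ineq2[of "f (Complex x h)" "f (Complex x H)"] by (simp add: norm_minus_commute)
    then have "ennreal (norm (f (Complex x h))) \<le> ennreal M + ennreal (norm (f (Complex x H) - f (Complex x h)))"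
      using M0 by (simp flip: ennreal_plus)
    ultimately show ?thesis using True by (simp add: add_left_mono order.trans)
  qed simp
  have "(\<integral>\<^sup>+x. indicator {\<alpha>..\<beta>} x * ennreal (norm (f (Complex x h))) \<partial>lborel) \<le>
    (\<integral>\<^sup>+x. ennreal M * indicator {\<alpha>..\<beta>} x +
      ennreal \<bar>H - h\<bar> * (\<integral>\<^sup>+s. indicator {0..1} s * grad (Complex x (h + (H - h) * s)) \<partial>lborel) \<partial>lborel)"
    by (intro nn_integral_mono ptw)
  also have "\<dots> = ennreal M * ennreal (\<beta> - \<alpha>) +
      ennreal \<bar>H - h\<bar> * (\<integral>\<^sup>+x. \<integral>\<^sup>+s. indicator {0..1} s * grad (Complex x (h + (H - h) * s)) \<partial>lborel \<partial>lborel)"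
    using \<alpha>\<beta> by (subst nn_integral_add) (auto simp: nn_integral_cmult)
  also have "(\<integral>\<^sup>+x. \<integral>\<^sup>+s. indicator {0..1} s * grad (Complex x (h + (H - h) * s)) \<partial>lborel \<partial>lborel) =
      (\<integral>\<^sup>+s. indicator {0..1} s * (\<integral>\<^sup>+x. grad (Complex x (h + (H - h) * s)) \<partial>lborel) \<partial>lborel)"
    by (subst lborel_pair.Fubini') (auto simp: nn_integral_cmult)
  also have "ennreal M * ennreal (\<beta> - \<alpha>) + ennreal \<bar>H - h\<bar> * \<dots> \<le> ennreal (M * (\<beta> - \<alpha>)) + strip H"
  proof (intro add_mono vertical_le)
    show "ennreal M * ennreal (\<beta> - \<alpha>) \<le> ennreal (M * (\<beta> - \<alpha>))" using M0 \<alpha>\<beta> by (simp add: ennreal_mult)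
    show "\<bar>h + (H - h) * s\<bar> \<le> H" if s: "s \<in> {0..1}" for s
    proof -
      have "(H - h) * s \<le> H - h" "0 \<le> (H - h) * s"
        using s h by (simp_all add: mult_left_le)
      then show ?thesis using h by linarith
    qed
  qed (use h in auto)
  finally show ?thesis .
qed

end

section \<open>Removing the slit by Cauchy integrals\<close>

context slit_box
begin

text \<open>The Cauchy kernel with pole \<open>w\<close> times \<open>f\<close>, integrated along a horizontal segment, along a vertical
  segment, and around a rectangle. Working with \<open>rect\<close> as a combination of four segments makes
  it additive in the height even when the rectangle contains part of the slit.\<close>

definition hor :: "complex \<Rightarrow> real \<Rightarrow> complex" where
  "hor w y = contour_integral (linepath (Complex \<alpha> y) (Complex \<beta> y)) (\<lambda>z. f z / (z - w))"

definition ver :: "complex \<Rightarrow> real \<Rightarrow> real \<Rightarrow> real \<Rightarrow> complex" where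
  "ver w x y1 y2 = contour_integral (linepath (Complex x y1) (Complex x y2)) (\<lambda>z. f z / (z - w))"

definition rect :: "complex \<Rightarrow> real \<Rightarrow> real \<Rightarrow> complex" where
  "rect w y1 y2 = hor w y1 + ver w \<beta> y1 y2 - hor w y2 - ver w \<alpha> y1 y2"

lemma f_continuous: "S \<subseteq> slit_rect \<Longrightarrow> continuous_on S f"
  using holomorphic_on_imp_continuous_on[OF hol] slit_rect_sub continuous_on_subset by blast

lemma kernel_continuous: "S \<subseteq> slit_rect - {w} \<Longrightarrow> continuous_on S (\<lambda>z. f z / (z - w))"
  by (intro continuous_intros f_continuous) auto

lemma hor_segment:
  assumes "\<bar>y\<bar> \<le> H" "y \<noteq> 0"
  shows "closed_segment (Complex \<alpha> y) (Complex \<beta> y) \<subseteq> slit_rect \<inter> {z. Im z = y}"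
  using assms \<alpha>\<beta> by (auto simp: closed_segment_same_Im closed_segment_eq_real_ivl in_slit_rect)

lemma ver_segment:
  assumes "x = \<alpha> \<or> x = \<beta>" "-H \<le> y1" "y1 \<le> y2" "y2 \<le> H"
  shows "closed_segment (Complex x y1) (Complex x y2) \<subseteq> slit_rect \<inter> {z. Re z = x}"
proof
  fix z assume "z \<in> closed_segment (Complex x y1) (Complex x y2)"
  then have z: "Re z = x" "y1 \<le> Im z" "Im z \<le> y2"
    using assms by (auto simp: closed_segment_same_Re closed_segment_eq_real_ivl)
  have "x \<notin> K" "\<alpha> \<le> x" "x \<le> \<beta>" using assms(1) ends \<alpha>\<beta> by auto
  then show "z \<in> slit_rect \<inter> {z. Re z = x}" using z assms by (simp add: in_slit_rect abs_le_iff)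
qed

text \<open>With the kernel \<open>k\<close>, the difference of the integrands is
  \<open>(k(x + i \<rho>) - k(x - i \<rho>)) f(x + i \<rho>) + k(x - i \<rho>) (f(x + i \<rho>) - f(x - i \<rho>))\<close>. The first term is
  \<open>O(\<rho>)\<close> in the mean by \<open>line_le\<close>. The second passes through the value of \<open>f\<close> at the squeezed point and
  is \<open>O(\<surd>\<rho> / \<theta>)\<close>. Porosity with \<open>\<eta> \<le> 1/4\<close> gives \<open>1 / \<theta> \<le> \<rho> powr (-1/4)\<close>, so the second term is \<open>O(\<rho> powr (1/4))\<close>.\<close>

lemma jump_small:
  assumes K: "log_porous K" and w: "Im w \<noteq> 0" and \<kappa>: "0 < \<kappa>" and h0: "0 < h0"
  obtains h where "0 < h" "h < h0" "norm (hor w h - hor w (-h)) \<le> \<kappa>"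
proof -
  define m where "m = 2 / \<bar>Im w\<bar>"
  have m: "0 < m" using w by (simp add: m_def)
  obtain M where M: "\<And>x. x \<in> {\<alpha>..\<beta>} \<Longrightarrow> norm (f (Complex x H)) \<le> M"
  proof -
    have "continuous_on {\<alpha>..\<beta>} (\<lambda>x. f (Complex x H))"
      by (rule continuous_on_compose2[OF f_continuous[OF order_refl]])
        (use H in \<open>auto simp: Complex_eq in_slit_rect intro!: continuous_intros\<close>)
    then have "bounded ((\<lambda>x. f (Complex x H)) ` {\<alpha>..\<beta>})"
      by (intro compact_imp_bounded compact_continuous_image) auto
    then obtain M where "\<And>x. x \<in> {\<alpha>..\<beta>} \<Longrightarrow> norm (f (Complex x H)) \<le> M" unfolding bounded_iff by blast
    then show ?thesis by (rule that)
  qed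
  define L where "L = \<bar>M\<bar> * (\<beta> - \<alpha>) + sqrt H * energy_bound"
  have L: "0 \<le> L" using \<alpha>\<beta> H energy_bound_pos by (simp add: L_def)
  define \<Phi> where "\<Phi> r = 2 * r * m\<^sup>2 * L + 4 * m * energy_bound * r powr (1/4)" for r
  have "(\<Phi> \<longlongrightarrow> 2 * 0 * m\<^sup>2 * L + 4 * m * energy_bound * 0) (at_right 0)"
  proof -
    have "((\<lambda>r::real. r powr (1/4)) \<longlongrightarrow> 0) (at_right 0)" by real_asymp
    then show ?thesis unfolding \<Phi>_def by (intro tendsto_intros)
  qed
  then have "\<forall>\<^sub>F r in at_right 0. \<Phi> r < \<kappa>"
    by (rule order_tendstoD) (use \<kappa> in auto)
  then obtain b where b: "0 < b" "\<And>r. 0 < r \<Longrightarrow> r < b \<Longrightarrow> \<Phi> r < \<kappa>"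
    unfolding eventually_at_right_field by auto
  \<comment> \<open>the last bound keeps the lines at height \<open>\<plusminus>\<rho>\<close> at distance at least \<open>|Im w| / 2\<close> from the pole\<close>
  define \<eta> where "\<eta> = Min {b, 1/4, h0, H, \<bar>Im w\<bar> / 2}"
  have \<eta>: "0 < \<eta>" "\<eta> \<le> b" "\<eta> \<le> 1/4" "\<eta> \<le> h0" "\<eta> \<le> H" "\<eta> \<le> \<bar>Im w\<bar> / 2"
    using b(1) h0 H w by (auto simp: \<eta>_def)
  obtain C \<rho> \<theta> where C: "separated_balls C \<rho>" "\<rho> < \<eta>" "0 < \<theta>" "\<theta> \<le> 1/2"
    "ln (1 / \<theta>) \<le> \<eta> * ln (1 / (2 * \<rho>))" "K \<subseteq> (\<Union>c\<in>C. ball c \<rho>)"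
    "\<And>c. c \<in> C \<Longrightarrow> {\<alpha>, \<beta>} \<inter> ball c \<rho> = {}" "\<And>c. c \<in> C \<Longrightarrow> cball c (\<theta> * \<rho>) \<subseteq> {0..1} - K"
  proof (rule log_porousE[OF K \<eta>(1), of "{\<alpha>, \<beta>}"])
    show "finite {\<alpha>, \<beta>}" "{\<alpha>, \<beta>} \<inter> K = {}" using ends by auto
  qed (rule that)
  have \<rho>: "0 < \<rho>" using C(1) by (simp add: separated_balls_def)
  have hole: "cball c (\<theta> * \<rho>) \<inter> K = {}" if "c \<in> C" for c using C(8)[OF that] by blast
  have jump: "ennreal (norm (f (Complex x \<rho>) - f (Complex x (-\<rho>)))) \<le> fan C \<rho> \<theta> 1 x + fan C \<rho> \<theta> (-1) x"
    if x: "x \<in> {\<alpha>..\<beta>}" for x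
  proof -
    define v where "v = f (of_real (squeeze C \<rho> \<theta> x))"
    have \<rho>H: "\<rho> \<le> H" using C(2) \<eta>(5) by simp
    have up: "ennreal (norm (f (Complex x \<rho>) - v)) \<le> fan C \<rho> \<theta> 1 x"
      using norm_diff_squeeze_le[OF C(1,3,4) _ \<rho>H C(6,7) hole x, of 1] by (simp add: v_def)
    have low: "ennreal (norm (f (Complex x (-\<rho>)) - v)) \<le> fan C \<rho> \<theta> (-1) x"
      using norm_diff_squeeze_le[OF C(1,3,4) _ \<rho>H C(6,7) hole x, of "-1"] by (simp add: v_def)
    have "norm (f (Complex x \<rho>) - f (Complex x (-\<rho>))) \<le> norm (f (Complex x \<rho>) - v) + norm (f (Complex x (-\<rho>)) - v)"
      using norm_triangle_ineq4[of "f (Complex x \<rho>) - v" "f (Complex x (-\<rho>)) - v"] by simp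
    then have "ennreal (norm (f (Complex x \<rho>) - f (Complex x (-\<rho>)))) \<le>
        ennreal (norm (f (Complex x \<rho>) - v)) + ennreal (norm (f (Complex x (-\<rho>)) - v))"
      by (simp flip: ennreal_plus)
    also note add_mono[OF up low]
    finally show ?thesis .
  qed
  have away: "1 / norm (Complex x y - w) \<le> m" "Complex x y \<noteq> w" if y: "\<bar>y\<bar> = \<rho>" for x y
  proof -
    have "\<rho> \<le> \<bar>Im w\<bar> / 2" using C(2) \<eta>(6) by simp
    then have "\<bar>Im w\<bar> / 2 \<le> \<bar>Im (Complex x y - w)\<bar>"
      unfolding minus_complex.sel complex.sel using y by linarith
    also have "\<dots> \<le> norm (Complex x y - w)" by (rule abs_Im_le_cmod)
    finally have *: "\<bar>Im w\<bar> / 2 \<le> norm (Complex x y - w)" .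
    have p: "0 < \<bar>Im w\<bar> / 2" using w by simp
    have "1 / norm (Complex x y - w) \<le> 1 / (\<bar>Im w\<bar> / 2)"
      using divide_left_mono[OF * _ mult_pos_pos[OF less_le_trans[OF p *] p], of 1] by simp
    then show "1 / norm (Complex x y - w) \<le> m" by (simp add: m_def)
    show "Complex x y \<noteq> w" using * w by auto
  qed
  define \<phi> where "\<phi> z = f z / (z - w)" for z
  have ptw: "indicator {\<alpha>..\<beta>} x * ennreal (norm (\<phi> (Complex x \<rho>) - \<phi> (Complex x (-\<rho>)))) \<le>
      ennreal (2 * \<rho> * m\<^sup>2) * (indicator {\<alpha>..\<beta>} x * ennreal (norm (f (Complex x \<rho>)))) +
      ennreal m * (fan C \<rho> \<theta> 1 x + fan C \<rho> \<theta> (-1) x)" for x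
  proof (cases "x \<in> {\<alpha>..\<beta>}")
    case True
    let ?p = "Complex x \<rho>" and ?q = "Complex x (-\<rho>)"
    have aw: "1 / norm (?p - w) \<le> m" "?p \<noteq> w" "1 / norm (?q - w) \<le> m" "?q \<noteq> w"
      using away[of \<rho>] away[of "-\<rho>"] \<rho> by auto
    have "\<phi> ?p - \<phi> ?q = f ?p * ((?q - ?p) / ((?p - w) * (?q - w))) + (f ?p - f ?q) / (?q - w)"
      using aw by (simp add: \<phi>_def divide_simps) (simp add: algebra_simps)
    then have "norm (\<phi> ?p - \<phi> ?q) \<le>
        norm (f ?p * ((?q - ?p) / ((?p - w) * (?q - w)))) + norm ((f ?p - f ?q) / (?q - w))"
      by (metis norm_triangle_ineq)
    also have "norm (f ?p * ((?q - ?p) / ((?p - w) * (?q - w)))) \<le> norm (f ?p) * (2 * \<rho> * (m * m))"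
    proof -
      have "norm (?q - ?p) = 2 * \<rho>" using \<rho> by (subst cmod_eq_Im) auto
      moreover have "1 / norm (?p - w) * (1 / norm (?q - w)) \<le> m * m" using aw m by (intro mult_mono) auto
      moreover have "norm ((?q - ?p) / ((?p - w) * (?q - w))) =
          norm (?q - ?p) * (1 / norm (?p - w) * (1 / norm (?q - w)))"
        by (simp add: norm_divide norm_mult)
      ultimately have "norm ((?q - ?p) / ((?p - w) * (?q - w))) \<le> 2 * \<rho> * (m * m)"
        using \<rho> by (simp only: mult_left_mono)
      then show ?thesis by (simp only: norm_mult mult_left_mono norm_ge_zero)
    qed
    also have "norm ((f ?p - f ?q) / (?q - w)) \<le> m * norm (f ?p - f ?q)"
      using mult_right_mono[OF aw(3), of "norm (f ?p - f ?q)"] by (simp add: norm_divide)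
    finally have "norm (\<phi> ?p - \<phi> ?q) \<le> 2 * \<rho> * m\<^sup>2 * norm (f ?p) + m * norm (f ?p - f ?q)"
      by (simp add: power2_eq_square mult_ac)
    then have "ennreal (norm (\<phi> ?p - \<phi> ?q)) \<le>
        ennreal (2 * \<rho> * m\<^sup>2) * ennreal (norm (f ?p)) + ennreal m * ennreal (norm (f ?p - f ?q))"
      using \<rho> m by (simp flip: ennreal_plus ennreal_mult)
    also have "\<dots> \<le> ennreal (2 * \<rho> * m\<^sup>2) * ennreal (norm (f ?p)) + ennreal m * (fan C \<rho> \<theta> 1 x + fan C \<rho> \<theta> (-1) x)"
      by (intro add_left_mono mult_left_mono jump[OF True]) simp
    finally show ?thesis using True by simp
  qed simp
  have fmeas [measurable]: "(\<lambda>x. indicator {\<alpha>..\<beta>} x * ennreal (norm (f (Complex x \<rho>)))) \<in> borel_measurable borel"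
  proof -
    have "continuous_on {\<alpha>..\<beta>} (\<lambda>x. norm (f (Complex x \<rho>)))"
      by (intro continuous_on_norm continuous_on_compose2[OF f_continuous[OF order_refl]])
        (use \<rho> C(2) \<eta>(5) in \<open>auto simp: Complex_eq in_slit_rect intro!: continuous_intros\<close>)
    from borel_measurable_continuous_on_indicator[OF _ this]
    have [measurable]: "(\<lambda>x. indicator {\<alpha>..\<beta>} x * norm (f (Complex x \<rho>))) \<in> borel_measurable borel" by simp
    have "(\<lambda>x. ennreal (indicator {\<alpha>..\<beta>} x * norm (f (Complex x \<rho>)))) \<in> borel_measurable borel" by measurable
    also have "(\<lambda>x. ennreal (indicator {\<alpha>..\<beta>} x * norm (f (Complex x \<rho>)))) =
        (\<lambda>x. indicator {\<alpha>..\<beta>} x * ennreal (norm (f (Complex x \<rho>))))"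
      by (auto simp: indicator_def)
    finally show ?thesis .
  qed
  have line: "(\<integral>\<^sup>+x. indicator {\<alpha>..\<beta>} x * ennreal (norm (f (Complex x \<rho>))) \<partial>lborel) \<le> ennreal L"
  proof -
    have M': "norm (f (Complex x H)) \<le> \<bar>M\<bar>" if "x \<in> {\<alpha>..\<beta>}" for x using M[OF that] by linarith
    have "\<rho> < H" using C(2) \<eta>(5) by simp
    from line_le[OF \<rho> this M']
    have "(\<integral>\<^sup>+x. indicator {\<alpha>..\<beta>} x * ennreal (norm (f (Complex x \<rho>))) \<partial>lborel) \<le>
        ennreal (\<bar>M\<bar> * (\<beta> - \<alpha>)) + strip H" by simp
    also have "\<dots> \<le> ennreal (\<bar>M\<bar> * (\<beta> - \<alpha>)) + ennreal (sqrt H * energy_bound)"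
      by (intro add_left_mono strip_le H)
    also have "\<dots> = ennreal L" using \<alpha>\<beta> H energy_bound_pos by (simp add: L_def flip: ennreal_plus)
    finally show ?thesis .
  qed
  have fans: "(\<integral>\<^sup>+x. fan C \<rho> \<theta> \<sigma> x \<partial>lborel) \<le> ennreal (2 * energy_bound * \<rho> powr (1/4))" if "\<bar>\<sigma>\<bar> = 1" for \<sigma>
  proof -
    have \<rho>1: "2 * \<rho> < 1" using C(2) \<eta>(3) by simp
    then have "0 \<le> ln (1 / (2 * \<rho>))" using \<rho> by simp
    then have "\<eta> * ln (1 / (2 * \<rho>)) \<le> 1/4 * ln (1 / (2 * \<rho>))" using \<eta>(3) by (rule mult_right_mono[rotated])
    also have "\<dots> \<le> 1/4 * ln (1 / \<rho>)" using \<rho> by (simp add: ln_div ln_mult)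
    finally have "ln (1 / \<theta>) \<le> ln ((1 / \<rho>) powr (1/4))" using C(5) \<rho> by (simp add: ln_powr)
    then have "1 / \<theta> \<le> (1 / \<rho>) powr (1/4)" using C(3) \<rho> by (subst (asm) ln_le_cancel_iff) auto
    also have "\<dots> = \<rho> powr (-1/4)" using \<rho> by (simp add: powr_minus_divide powr_divide)
    finally have "1 / \<theta> * sqrt \<rho> \<le> \<rho> powr (-1/4) * sqrt \<rho>"
      using \<rho> by (intro mult_right_mono) auto
    also have "\<dots> = \<rho> powr (1/4)"
    proof -
      have "sqrt \<rho> = \<rho> powr (1/2)" using \<rho> by (simp add: powr_half_sqrt)
      then show ?thesis by (simp flip: powr_add)
    qed
    finally have le: "1 / \<theta> * sqrt \<rho> \<le> \<rho> powr (1/4)" .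
    have "(\<integral>\<^sup>+x. fan C \<rho> \<theta> \<sigma> x \<partial>lborel) \<le> ennreal (2 / \<theta>) * strip \<rho>"
      by (rule nn_integral_fan_le[OF C(1,3,4) that])
    also have "\<dots> \<le> ennreal (2 / \<theta>) * ennreal (sqrt \<rho> * energy_bound)"
      by (intro mult_left_mono strip_le \<rho>) simp
    also have "\<dots> = ennreal (2 * energy_bound * (1 / \<theta> * sqrt \<rho>))"
      using C(3) \<rho> energy_bound_pos by (simp add: mult_ac flip: ennreal_mult)
    also have "\<dots> \<le> ennreal (2 * energy_bound * \<rho> powr (1/4))"
      using energy_bound_pos le by (intro ennreal_leI mult_left_mono) auto
    finally show ?thesis .
  qed
  have seg: "closed_segment (Complex \<alpha> y) (Complex \<beta> y) \<subseteq> slit_rect - {w}" if "\<bar>y\<bar> = \<rho>" for y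
  proof -
    have "closed_segment (Complex \<alpha> y) (Complex \<beta> y) \<subseteq> slit_rect \<inter> {z. Im z = y}"
      using that \<rho> C(2) \<eta>(5) by (intro hor_segment) auto
    moreover have "Im w \<noteq> y" using that C(2) \<eta>(6) by auto
    ultimately show ?thesis by auto
  qed
  have "ennreal (norm (hor w \<rho> - hor w (-\<rho>))) \<le>
      (\<integral>\<^sup>+x. indicator {\<alpha>..\<beta>} x * ennreal (norm (\<phi> (Complex x \<rho>) - \<phi> (Complex x (-\<rho>)))) \<partial>lborel)"
    unfolding hor_def \<phi>_def using \<rho>
    by (intro horizontal_integrals_diff_le \<alpha>\<beta> kernel_continuous seg) auto
  also have "\<dots> \<le> (\<integral>\<^sup>+x. ennreal (2 * \<rho> * m\<^sup>2) * (indicator {\<alpha>..\<beta>} x * ennreal (norm (f (Complex x \<rho>)))) +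
      ennreal m * (fan C \<rho> \<theta> 1 x + fan C \<rho> \<theta> (-1) x) \<partial>lborel)"
    by (intro nn_integral_mono ptw)
  also have "\<dots> = ennreal (2 * \<rho> * m\<^sup>2) * (\<integral>\<^sup>+x. indicator {\<alpha>..\<beta>} x * ennreal (norm (f (Complex x \<rho>))) \<partial>lborel) +
      ennreal m * ((\<integral>\<^sup>+x. fan C \<rho> \<theta> 1 x \<partial>lborel) + (\<integral>\<^sup>+x. fan C \<rho> \<theta> (-1) x \<partial>lborel))"
    using fmeas by (simp add: nn_integral_add nn_integral_cmult)
  also have "\<dots> \<le> ennreal (2 * \<rho> * m\<^sup>2) * ennreal L +
      ennreal m * (ennreal (2 * energy_bound * \<rho> powr (1/4)) + ennreal (2 * energy_bound * \<rho> powr (1/4)))"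
    by (intro add_mono mult_left_mono line fans) auto
  also have "\<dots> = ennreal (\<Phi> \<rho>)"
    using \<rho> m L energy_bound_pos by (simp add: \<Phi>_def algebra_simps flip: ennreal_mult ennreal_plus)
  finally have "norm (hor w \<rho> - hor w (-\<rho>)) \<le> \<Phi> \<rho>"
    using \<rho> m L energy_bound_pos by (subst (asm) ennreal_le_iff) (auto simp: \<Phi>_def)
  also have "\<dots> \<le> \<kappa>" using b(2)[OF \<rho>] C(2) \<eta>(2) by simp
  finally show ?thesis using that[OF \<rho>] C(2) \<eta>(4) by simp
qed

lemma rect_split:
  assumes y: "-H \<le> y1" "y1 \<le> y2" "y2 \<le> y3" "y3 \<le> H" and w: "\<alpha> < Re w" "Re w < \<beta>"
  shows "rect w y1 y3 = rect w y1 y2 + rect w y2 y3"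
proof -
  have "ver w x y1 y3 = ver w x y1 y2 + ver w x y2 y3" if x: "x = \<alpha> \<or> x = \<beta>" for x
    unfolding ver_def
  proof (rule contour_integral_split_linepath)
    have "closed_segment (Complex x y1) (Complex x y3) \<subseteq> slit_rect - {w}"
      using ver_segment[OF x y(1) _ y(4)] y w x by fastforce
    then show "continuous_on (closed_segment (Complex x y1) (Complex x y3)) (\<lambda>z. f z / (z - w))"
      by (rule kernel_continuous)
    show "Complex x y2 \<in> closed_segment (Complex x y1) (Complex x y3)"
      using y by (simp add: closed_segment_same_Re closed_segment_eq_real_ivl)
  qed
  then show ?thesis by (simp add: rect_def)
qed

lemma rect_eq_rectpath:
  assumes y: "-H \<le> y1" "y1 \<le> y2" "y2 \<le> H" "y1 \<noteq> 0" "y2 \<noteq> 0"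
    and w: "\<alpha> < Re w" "Re w < \<beta>" "Im w \<noteq> y1" "Im w \<noteq> y2"
  shows "((\<lambda>z. f z / (z - w)) has_contour_integral rect w y1 y2) (rectpath (Complex \<alpha> y1) (Complex \<beta> y2))"
proof -
  have v: "closed_segment (Complex x y1) (Complex x y2) \<subseteq> slit_rect - {w}" if x: "x = \<alpha> \<or> x = \<beta>" for x
    using ver_segment[OF x y(1-3)] w x by fastforce
  have h: "closed_segment (Complex \<alpha> u) (Complex \<beta> u) \<subseteq> slit_rect - {w}" if u: "u = y1 \<or> u = y2" for u
    using hor_segment[of u] y w u by fastforce
  have I: "((\<lambda>z. f z / (z - w)) has_contour_integral contour_integral (linepath p q) (\<lambda>z. f z / (z - w))) (linepath p q)"
    if "closed_segment p q \<subseteq> slit_rect - {w}" for p q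
    by (intro has_contour_integral_integral contour_integrable_continuous_linepath kernel_continuous that)
  have rev: "contour_integral (linepath q p) (\<lambda>z. f z / (z - w)) = - contour_integral (linepath p q) (\<lambda>z. f z / (z - w))"
    if "closed_segment p q \<subseteq> slit_rect - {w}" for p q
    using that by (intro contour_integral_reverse_linepath kernel_continuous) (simp add: closed_segment_commute)
  have "((\<lambda>z. f z / (z - w)) has_contour_integral
      (contour_integral (linepath (Complex \<alpha> y1) (Complex \<beta> y1)) (\<lambda>z. f z / (z - w)) +
      (contour_integral (linepath (Complex \<beta> y1) (Complex \<beta> y2)) (\<lambda>z. f z / (z - w)) +
      (contour_integral (linepath (Complex \<beta> y2) (Complex \<alpha> y2)) (\<lambda>z. f z / (z - w)) +
       contour_integral (linepath (Complex \<alpha> y2) (Complex \<alpha> y1)) (\<lambda>z. f z / (z - w))))))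
      (rectpath (Complex \<alpha> y1) (Complex \<beta> y2))"
    unfolding rectpath_def Let_def complex.sel
    by (intro has_contour_integral_join I valid_path_join valid_path_linepath)
      (use v h in \<open>simp_all add: closed_segment_commute\<close>)
  then show ?thesis
    unfolding rect_def hor_def ver_def
    using rev[OF h[of y2]] rev[OF v[of \<alpha>]] by (simp add: algebra_simps)
qed

lemma rect_half:
  assumes y: "-H \<le> y1" "y1 < y2" "y2 \<le> H" "0 < y1 \<or> y2 < 0"
    and w: "\<alpha> < Re w" "Re w < \<beta>" "Im w \<noteq> y1" "Im w \<noteq> y2"
  shows "rect w y1 y2 = (if y1 < Im w \<and> Im w < y2 then 2 * of_real pi * \<i> * f w else 0)"
proof -
  let ?S = "cbox (Complex \<alpha> y1) (Complex \<beta> y2)"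
  let ?\<gamma> = "rectpath (Complex \<alpha> y1) (Complex \<beta> y2)"
  have SR: "?S \<subseteq> slit_rect" using y by (auto simp: in_cbox_complex_iff in_slit_rect)
  have holS: "f holomorphic_on ?S" using hol SR slit_rect_sub holomorphic_on_subset by blast
  have im: "path_image ?\<gamma> = ?S - box (Complex \<alpha> y1) (Complex \<beta> y2)"
    using y \<alpha>\<beta> by (intro path_image_rectpath_cbox_minus_box) auto
  have I: "((\<lambda>z. f z / (z - w)) has_contour_integral rect w y1 y2) ?\<gamma>"
    using y w by (intro rect_eq_rectpath) auto
  show ?thesis
  proof (cases "y1 < Im w \<and> Im w < y2")
    case True
    then have wb: "w \<in> box (Complex \<alpha> y1) (Complex \<beta> y2)" using w by (simp add: in_box_complex_iff)
    have "((\<lambda>z. f z / (z - w)) has_contour_integral (2 * pi * \<i> * winding_number ?\<gamma> w * f w)) ?\<gamma>"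
      using wb im by (intro Cauchy_integral_formula_convex_simple[OF convex_box(1) holS]) (auto simp: interior_cbox)
    then show ?thesis
      using has_contour_integral_unique[OF I] winding_number_rectpath[OF wb] True by simp
  next
    case False
    then have "w \<notin> ?S" using w by (auto simp: in_cbox_complex_iff)
    then have "(\<lambda>z. f z / (z - w)) holomorphic_on ?S" by (intro holomorphic_intros holS) auto
    then have "((\<lambda>z. f z / (z - w)) has_contour_integral 0) ?\<gamma>"
      by (rule Cauchy_theorem_convex_simple) (use im in \<open>auto intro: convex_box\<close>)
    then show ?thesis using has_contour_integral_unique[OF I] False by auto
  qed
qed

text \<open>The rectangle is cut at the heights \<open>\<plusminus>h\<close>. The outer parts contribute \<open>2 \<pi> i f(w)\<close> by Cauchy's formula,
  and the thin middle part is small: its horizontal sides by \<open>jump_small\<close>, its vertical sides because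
  they are short and stay away from \<open>K\<close>.\<close>

lemma rect_eq:
  assumes K: "log_porous K" and w: "\<alpha> < Re w" "Re w < \<beta>" "\<bar>Im w\<bar> < H" "Im w \<noteq> 0"
  shows "rect w (-H) H = 2 * of_real pi * \<i> * f w"
proof -
  obtain N where N: "0 \<le> N" "\<And>x y. x = \<alpha> \<or> x = \<beta> \<Longrightarrow> \<bar>y\<bar> \<le> H \<Longrightarrow> norm (f (Complex x y) / (Complex x y - w)) \<le> N"
  proof -
    let ?S = "closed_segment (Complex \<alpha> (-H)) (Complex \<alpha> H) \<union> closed_segment (Complex \<beta> (-H)) (Complex \<beta> H)"
    have "?S \<subseteq> slit_rect - {w}" using ver_segment[of \<alpha> "-H" H] ver_segment[of \<beta> "-H" H] H w by fastforce
    then have "bounded ((\<lambda>z. f z / (z - w)) ` ?S)"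
      by (intro compact_imp_bounded compact_continuous_image kernel_continuous) auto
    then obtain N where N: "\<And>z. z \<in> ?S \<Longrightarrow> norm (f z / (z - w)) \<le> N" unfolding bounded_iff by blast
    show ?thesis
    proof (rule that[of "\<bar>N\<bar>"])
      fix x y :: real assume "x = \<alpha> \<or> x = \<beta>" "\<bar>y\<bar> \<le> H"
      then have "Complex x y \<in> ?S" using H by (auto simp: closed_segment_same_Re closed_segment_eq_real_ivl)
      then show "norm (f (Complex x y) / (Complex x y - w)) \<le> \<bar>N\<bar>" using N by (meson abs_ge_self order.trans)
    qed simp
  qed
  have "norm (rect w (-H) H - 2 * of_real pi * \<i> * f w) \<le> 0 + \<kappa>" if \<kappa>: "0 < \<kappa>" for \<kappa>
  proof -
    define h0 where "h0 = min (\<bar>Im w\<bar>) (\<kappa> / (8 * (N + 1)))"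
    have h0: "0 < h0" using w \<kappa> N by (simp add: h0_def)
    obtain h where h: "0 < h" "h < h0" "norm (hor w h - hor w (-h)) \<le> \<kappa> / 2"
      using jump_small[OF K w(4) _ h0, of "\<kappa> / 2"] \<kappa> by auto
    have hw: "h < \<bar>Im w\<bar>" "h < H" using h w by (auto simp: h0_def)
    have "8 * (N + 1) * h \<le> \<kappa>"
      using h(2) N by (simp add: h0_def pos_less_divide_eq mult.commute)
    moreover have "8 * (N + 1) * h = 8 * (N * h) + 8 * h" by (simp add: algebra_simps)
    ultimately have small: "8 * (N * h) \<le> \<kappa>" using h by linarith
    have "rect w (-H) H = rect w (-H) (-h) + rect w (-h) h + rect w h H"
      using rect_split[of "-H" "-h" H w] rect_split[of "-h" h H w] h hw w by simp
    moreover have "rect w (-H) (-h) + rect w h H = 2 * of_real pi * \<i> * f w"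
      using rect_half[of "-H" "-h" w] rect_half[of h H w] h hw w by (auto simp: abs_if split: if_splits)
    ultimately have "rect w (-H) H - 2 * of_real pi * \<i> * f w = rect w (-h) h" by (simp add: algebra_simps)
    also have "norm (rect w (-h) h) \<le> norm (hor w h - hor w (-h)) + norm (ver w \<beta> (-h) h) + norm (ver w \<alpha> (-h) h)"
    proof -
      have eq: "rect w (-h) h = - (hor w h - hor w (-h)) + ver w \<beta> (-h) h - ver w \<alpha> (-h) h" by (simp add: rect_def)
      have tri: "norm (- a + b - c) \<le> norm a + norm b + norm c" for a b c :: complex
        using norm_triangle_ineq4[of "- a + b" c] norm_triangle_ineq[of "- a" b] by simp
      show ?thesis unfolding eq by (rule tri)
    qed
    also have "norm (ver w x (-h) h) \<le> N * (2 * h)" if x: "x = \<alpha> \<or> x = \<beta>" for x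
    proof -
      have seg: "closed_segment (Complex x (-h)) (Complex x h) \<subseteq> slit_rect \<inter> {z. Re z = x}"
        using x h hw by (intro ver_segment) auto
      have "norm (ver w x (-h) h) \<le> N * norm (Complex x h - Complex x (-h))"
        unfolding ver_def
      proof (rule contour_integral_bound_linepath)
        show "(\<lambda>z. f z / (z - w)) contour_integrable_on linepath (Complex x (-h)) (Complex x h)"
          using seg x w by (intro contour_integrable_continuous_linepath kernel_continuous) auto
        show "norm (f z / (z - w)) \<le> N" if "z \<in> closed_segment (Complex x (-h)) (Complex x h)" for z
        proof -
          have "z = Complex x (Im z)" "\<bar>Im z\<bar> \<le> H" using that seg by (auto simp: complex_eq_iff in_slit_rect)
          then show ?thesis using N(2)[OF x, of "Im z"] by metis
        qed
      qed (rule N)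
      also have "norm (Complex x h - Complex x (-h)) = 2 * h" using h by (subst cmod_eq_Im) auto
      finally show ?thesis .
    qed
    from this[of \<alpha>] this[of \<beta>] h(3) small
    have "norm (hor w h - hor w (-h)) + norm (ver w \<beta> (-h) h) + norm (ver w \<alpha> (-h) h) \<le> 0 + \<kappa>"
      by simp
    finally show ?thesis .
  qed
  then have "norm (rect w (-H) H - 2 * of_real pi * \<i> * f w) \<le> 0" by (rule field_le_epsilon)
  then show ?thesis by simp
qed

lemma line_integral_holomorphic:
  assumes S: "open S" and seg: "closed_segment p q \<subseteq> slit_rect - S"
  shows "(\<lambda>w. contour_integral (linepath p q) (\<lambda>z. f z / (z - w))) holomorphic_on S"
proof -
  have "\<exists>D. ((\<lambda>w. contour_integral (linepath p q) (\<lambda>z. f z / (z - w))) has_field_derivative D) (at w)"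
    if w: "w \<in> S" for w
  proof (rule exI, rule Cauchy_next_derivative(2))
    show "continuous_on (path_image (linepath p q)) f" using seg by (intro f_continuous) auto
    show "norm (vector_derivative (linepath p q) (at t)) \<le> norm (q - p)" for t
      by simp
    show "((\<lambda>u. f u / (u - w) ^ 1) has_contour_integral contour_integral (linepath p q) (\<lambda>z. f z / (z - w))) (linepath p q)"
      if "w \<in> S - path_image (linepath p q)" for w
      unfolding power_one_right using seg that
      by (intro has_contour_integral_integral contour_integrable_continuous_linepath kernel_continuous) auto
    show "w \<in> S - path_image (linepath p q)" using w seg by auto
  qed (use S in auto)
  then show ?thesis
    using S by (auto simp: holomorphic_on_open)
qed

text \<open>The extension is the Cauchy integral over the boundary of the rectangle. It agrees with \<open>f\<close> off the real
  line by \<open>rect_eq\<close>, hence also at the real points off \<open>K\<close> by continuity.\<close>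

lemma local_extension:
  assumes K: "log_porous K"
  obtains F where "F holomorphic_on box (Complex \<alpha> (-H)) (Complex \<beta> H)"
    "\<And>z. z \<in> box (Complex \<alpha> (-H)) (Complex \<beta> H) - of_real ` K \<Longrightarrow> F z = f z"
proof -
  let ?B = "box (Complex \<alpha> (-H)) (Complex \<beta> H)"
  define F where "F w = rect w (-H) H / (2 * of_real pi * \<i>)" for w
  have "(\<lambda>w. rect w (-H) H) holomorphic_on ?B"
    unfolding rect_def hor_def ver_def
  proof (intro holomorphic_intros line_integral_holomorphic open_box)
    show "closed_segment (Complex \<alpha> H) (Complex \<beta> H) \<subseteq> slit_rect - ?B"
      using hor_segment[of H] H by (auto simp: in_box_complex_iff)
    show "closed_segment (Complex \<alpha> (-H)) (Complex \<beta> (-H)) \<subseteq> slit_rect - ?B"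
      using hor_segment[of "-H"] H by (auto simp: in_box_complex_iff)
    show "closed_segment (Complex \<beta> (-H)) (Complex \<beta> H) \<subseteq> slit_rect - ?B"
      using ver_segment[of \<beta> "-H" H] H by (auto simp: in_box_complex_iff)
    show "closed_segment (Complex \<alpha> (-H)) (Complex \<alpha> H) \<subseteq> slit_rect - ?B"
      using ver_segment[of \<alpha> "-H" H] H by (auto simp: in_box_complex_iff)
  qed
  then have holF: "F holomorphic_on ?B" unfolding F_def by (intro holomorphic_intros) auto
  have off: "F w = f w" if "w \<in> ?B" "Im w \<noteq> 0" for w
    using rect_eq[OF K, of w] that by (auto simp: F_def in_box_complex_iff abs_less_iff)
  show ?thesis
  proof (rule that[OF holF])
    fix z assume z: "z \<in> ?B - of_real ` K"
    have "F z = f z" if "Im z = 0"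
    proof -
      have zU: "z \<in> U - of_real ` K" using z box_sub box_subset_cbox by blast
      define u where "u n = z + \<i> * of_real (inverse (real (Suc n)))" for n
      have "(\<lambda>n. z + \<i> * of_real (inverse (real (Suc n)))) \<longlonglongrightarrow> z + \<i> * of_real 0"
        by (intro tendsto_intros LIMSEQ_inverse_real_of_nat)
      then have u: "u \<longlonglongrightarrow> z" by (simp add: u_def[abs_def])
      have "isCont F z" using holF z
        using holomorphic_on_imp_continuous_on[OF holF] by (simp add: continuous_on_eq_continuous_at open_box)
      then have 1: "(\<lambda>n. F (u n)) \<longlonglongrightarrow> F z" by (rule isCont_tendsto_compose[OF _ u])
      have "isCont f z" using hol open_domain zU
        using holomorphic_on_imp_continuous_on[OF hol] by (simp add: continuous_on_eq_continuous_at)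
      then have 2: "(\<lambda>n. f (u n)) \<longlonglongrightarrow> f z" by (rule isCont_tendsto_compose[OF _ u])
      have "\<forall>\<^sub>F n in sequentially. u n \<in> ?B"
        using u z by (intro topological_tendstoD) (auto simp: open_box)
      then have "\<forall>\<^sub>F n in sequentially. F (u n) = f (u n)"
        by eventually_elim (use off that in \<open>auto simp: u_def\<close>)
      from Lim_transform_eventually[OF 1 this] have "(\<lambda>n. f (u n)) \<longlonglongrightarrow> F z" .
      then show ?thesis using 2 by (rule LIMSEQ_unique)
    qed
    then show "F z = f z" using off z by blast
  qed
qed

end

section \<open>Removability\<close>

text \<open>The end points of a covering interval are at distance at least \<open>\<rho>\<close> from all centres, and hence
  not in \<open>K\<close>.\<close>

lemma log_porous_isolating_interval:
  assumes K: "log_porous K" and p: "p \<in> K" and \<delta>: "0 < \<delta>"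
  obtains \<alpha> \<beta> where "\<alpha> < p" "p < \<beta>" "\<alpha> \<notin> K" "\<beta> \<notin> K" "{\<alpha>..\<beta>} \<subseteq> ball p \<delta>"
proof -
  have \<delta>2: "0 < \<delta> / 2" using \<delta> by simp
  obtain C \<rho> where C: "separated_balls C \<rho>" "\<rho> < \<delta> / 2" "K \<subseteq> (\<Union>c\<in>C. ball c \<rho>)"
    by (rule log_porousE[OF K \<delta>2, of "{}"]) (auto intro: that)
  interpret separated_balls C \<rho> by (rule C(1))
  obtain c where c: "c \<in> C" "p \<in> ball c \<rho>" using C(3) p by blast
  have "x \<notin> K" if x: "dist c x = \<rho>" for x
  proof
    assume "x \<in> K"
    then obtain d where d: "d \<in> C" "x \<in> ball d \<rho>" using C(3) by blast
    then have "c \<noteq> d" using x by auto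
    then have "2 * \<rho> \<le> dist c d" using sep c d by blast
    then show False using x d dist_triangle[of c d x] by (auto simp: dist_commute)
  qed
  then have "c - \<rho> \<notin> K" "c + \<rho> \<notin> K" using pos by (auto simp: dist_real_def)
  then show ?thesis
    using c(2) C(2) by (intro that[of "c - \<rho>" "c + \<rho>"]) (auto simp: dist_real_def)
qed

lemma log_porous_slit_box:
  assumes K: "log_porous K" "closed K" and p: "p \<in> K"
    and U: "open U" "complex_of_real ` K \<subseteq> U"
    and hol: "f holomorphic_on U - complex_of_real ` K"
    and fin: "dirichlet_integral (U - complex_of_real ` K) f < \<infinity>"
  obtains \<alpha> \<beta> H where "slit_box U K f \<alpha> \<beta> H" "complex_of_real p \<in> box (Complex \<alpha> (-H)) (Complex \<beta> H)"
proof -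
  have "complex_of_real p \<in> U" using p U by auto
  then obtain e where e: "0 < e" "cball (complex_of_real p) e \<subseteq> U"
    using U(1) open_contains_cball by blast
  define H where "H = e / 2"
  have H: "0 < H" using e by (simp add: H_def)
  obtain \<alpha> \<beta> where ab: "\<alpha> < p" "p < \<beta>" "\<alpha> \<notin> K" "\<beta> \<notin> K" "{\<alpha>..\<beta>} \<subseteq> ball p H"
    by (rule log_porous_isolating_interval[OF K(1) p H])
  have "cbox (Complex \<alpha> (-H)) (Complex \<beta> H) \<subseteq> cball (complex_of_real p) e"
  proof
    fix z assume "z \<in> cbox (Complex \<alpha> (-H)) (Complex \<beta> H)"
    then have z: "Re z \<in> {\<alpha>..\<beta>}" "\<bar>Im z\<bar> \<le> H" by (auto simp: in_cbox_complex_iff)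
    then have "Re z \<in> ball p H" using ab(5) by blast
    then have "\<bar>Re (complex_of_real p - z)\<bar> + \<bar>Im (complex_of_real p - z)\<bar> \<le> e"
      using z(2) by (simp add: dist_real_def H_def)
    then show "z \<in> cball (complex_of_real p) e"
      using cmod_le[of "complex_of_real p - z"] by (simp add: dist_norm)
  qed
  then have "slit_box U K f \<alpha> \<beta> H"
    using U K hol fin ab H e by unfold_locales auto
  then show ?thesis
    using ab H by (intro that) (auto simp: in_box_complex_iff)
qed

text \<open>The local extensions are patched together by a formula that does not depend on the rectangle: at a
  point of \<open>K\<close> the extension is the limit of \<open>f\<close> along the vertical from above.\<close>

lemma NED_log_porous:
  assumes K: "log_porous K" "compact K"
  shows "NED (complex_of_real ` K)"
  unfolding NED_def
proof (intro conjI allI impI)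
  show "compact (complex_of_real ` K)" using K by (intro compact_continuous_image continuous_intros)
  fix U f
  assume "open U \<and> complex_of_real ` K \<subseteq> U \<and> f holomorphic_on U - complex_of_real ` K \<and>
    dirichlet_integral (U - complex_of_real ` K) f < \<infinity>"
  then have U: "open U" "complex_of_real ` K \<subseteq> U" and hol: "f holomorphic_on U - complex_of_real ` K"
    and fin: "dirichlet_integral (U - complex_of_real ` K) f < \<infinity>" by auto
  have cl: "closed K" using K(2) by (rule compact_imp_closed)
  define u where "u z n = z + \<i> * of_real (inverse (real (Suc n)))" for z n
  have u: "u z \<longlonglongrightarrow> z" for z
  proof -
    have "(\<lambda>n. z + \<i> * of_real (inverse (real (Suc n)))) \<longlonglongrightarrow> z + \<i> * of_real 0"
      by (intro tendsto_intros LIMSEQ_inverse_real_of_nat)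
    then show ?thesis by (simp add: u_def[abs_def])
  qed
  define g where "g z = (if z \<in> complex_of_real ` K then lim (\<lambda>n. f (u z n)) else f z)" for z
  have local: "\<exists>B. open B \<and> p \<in> B \<and> g holomorphic_on B" if p: "p \<in> U" for p
  proof (cases "p \<in> complex_of_real ` K")
    case False
    have "closed (complex_of_real ` K)"
      using K(2) by (intro compact_imp_closed compact_continuous_image continuous_intros)
    then have "open (U - complex_of_real ` K)" using U(1) by (rule open_Diff[rotated])
    moreover have "g holomorphic_on U - complex_of_real ` K"
      using hol by (rule holomorphic_transform) (auto simp: g_def)
    ultimately show ?thesis using p False by blast
  next
    case True
    then obtain q where q: "q \<in> K" "p = of_real q" by auto
    obtain \<alpha> \<beta> H where box: "slit_box U K f \<alpha> \<beta> H" "complex_of_real q \<in> box (Complex \<alpha> (-H)) (Complex \<beta> H)"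
      by (rule log_porous_slit_box[OF K(1) cl q(1) U hol fin])
    let ?B = "box (Complex \<alpha> (-H)) (Complex \<beta> H)"
    obtain F where F: "F holomorphic_on ?B" "\<And>z. z \<in> ?B - of_real ` K \<Longrightarrow> F z = f z"
      by (rule slit_box.local_extension[OF box(1) K(1)]) (rule that)
    have "F z = g z" if z: "z \<in> ?B" for z
    proof (cases "z \<in> complex_of_real ` K")
      case True
      have "isCont F z"
        using holomorphic_on_imp_continuous_on[OF F(1)] z by (simp add: continuous_on_eq_continuous_at open_box)
      then have 1: "(\<lambda>n. F (u z n)) \<longlonglongrightarrow> F z" by (rule isCont_tendsto_compose[OF _ u])
      have "\<forall>\<^sub>F n in sequentially. u z n \<in> ?B"
        using u z by (intro topological_tendstoD) (auto simp: open_box)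
      then have "\<forall>\<^sub>F n in sequentially. F (u z n) = f (u z n)"
      proof eventually_elim
        case (elim n)
        have "Im z = 0" using True by auto
        then have "Im (u z n) \<noteq> 0" by (simp add: u_def)
        then have "u z n \<notin> complex_of_real ` K" by auto
        then show ?case using elim F(2) by blast
      qed
      from Lim_transform_eventually[OF 1 this] have "(\<lambda>n. f (u z n)) \<longlonglongrightarrow> F z" .
      then show ?thesis using True by (simp add: g_def limI)
    next
      case False
      then show ?thesis using F(2)[of z] z by (simp add: g_def)
    qed
    then have "g holomorphic_on ?B" using F(1) by (rule holomorphic_transform[rotated])
    then show ?thesis using box(2) q by (intro exI[of _ ?B]) (auto simp: open_box)
  qed
  have "g holomorphic_on U"
    unfolding holomorphic_on_def
  proof
    fix p assume "p \<in> U"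
    then obtain B where "open B" "p \<in> B" "g holomorphic_on B" using local by blast
    then show "g field_differentiable at p within U"
      using holomorphic_on_imp_differentiable_at field_differentiable_at_within by blast
  qed
  then show "\<exists>g. g holomorphic_on U \<and> (\<forall>z\<in>U - complex_of_real ` K. g z = f z)"
    by (intro exI[of _ g]) (auto simp: g_def)
qed


section \<open>Cantor-type sets with slowly decaying gaps\<close>

theorem theorem4p2:
  fixes \<epsilon> :: "nat \<Rightarrow> real" and C :: real
  assumes "\<forall>n\<ge>1. 0 < \<epsilon> n \<and> \<epsilon> n < 1"
    and "C < 1 / (24 * ln 2)"
    and "\<forall>n\<ge>2. ln (1 / \<epsilon> n) \<le> C * real n / ln (real n)"
  shows "log_capacity (complex_of_real ` ({0..1} - cantor_type_set \<epsilon>)) =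
           log_capacity (complex_of_real ` {0..1}) \<and>
         NED (complex_of_real ` cantor_type_set \<epsilon>)"
proof -
  have "log_porous (cantor_type_set \<epsilon>)"
    using ln_inverse_gap_sublinear[OF assms(1,3)] by (rule log_porous_cantor_type_set[OF assms(1)])
  then show ?thesis
    using compact_cantor_type_set(1)[OF assms(1)]
    by (intro conjI log_capacity_complement_log_porous NED_log_porous)
qed

end
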